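(* Let $R$ be a commutative ring and let $V$ be a finitely generated $\mathrm{FI}$-module over $R$ with $\deg(V)<\infty$. Then $\mathrm{reg}(V)=\deg(V)$.
   Context: Let $R$ be a commutative ring. $\mathrm{FI}$ denotes the category of finite sets and injective maps; an $\mathrm{FI}$-module is a covariant functor from $\mathrm{FI}$ to $R$-modules. For $n\in\mathbb{N}$, $[n]=\{1,\dots,n\}$. An $\mathrm{FI}$-module $V$ is finitely generated if there are finitely many elements $v_j\in V([n_j])$ such that every $V([n])$ is spanned over $R$ by the elements $\alpha(v_j)$ with $\alpha\in\mathrm{Hom}_{\mathrm{FI}}([n_j],[n])$. Let $A=\bigoplus_{0\le m\le n}A_{m,n}$, where $A_{m,n}$ is the free $R$-module on $\mathrm{Hom}_{\mathrm{FI}}([m],[n])$, with product $\alpha\beta=\alpha\circ\beta$ if composable and $0$ otherwise, and let $J=\bigoplus_{0\le m<n}A_{m,n}$. $\mathrm{FI}$-modules are identified with graded left $A$-modules via $V\mapsto\bigoplus_nV([n])$. The $\mathrm{FI}$-homology $H^{\mathrm{FI}}_a(V)=\mathrm{Tor}^A_a(A/J,V)$ is the $a$-th left derived functor of $V\mapsto V/JV$. The degree of an $\mathrm{FI}$-module $W$ is $\deg(W)=\sup\{n\in\mathbb{N}: W([n])\neq0\}$, with $\sup\emptyset=-\infty$. The Castelnuovo–Mumford regularity $\mathrm{reg}(V)$ is the infimum of the set of $c\in\mathbb{Z}$ such that $\deg(H^{\mathrm{FI}}_a(V))\le c+a$ for every $a\ge1$, with $\inf\emptyset=\infty$. *)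

theory Defs
  imports Main "HOL-Library.Extended_Real"
begin

text \<open>Morphisms [m] -> [n] of FI, i.e. injections {1..m} -> {1..n}, represented
  extensionally (value 0 outside {1..m}) so that each morphism has exactly one representative.\<close>

definition FI_hom :: "nat \<Rightarrow> nat \<Rightarrow> (nat \<Rightarrow> nat) set" where
  "FI_hom m n = {\<alpha>. inj_on \<alpha> {1..m} \<and> \<alpha> ` {1..m} \<subseteq> {1..n} \<and> (\<forall>k. k \<notin> {1..m} \<longrightarrow> \<alpha> k = 0)}"

definition FI_id :: "nat \<Rightarrow> nat \<Rightarrow> nat" where
  "FI_id m = (\<lambda>k. if k \<in> {1..m} then k else 0)"

definition FI_comp :: "nat \<Rightarrow> (nat \<Rightarrow> nat) \<Rightarrow> (nat \<Rightarrow> nat) \<Rightarrow> nat \<Rightarrow> nat" where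
  "FI_comp m \<beta> \<alpha> = (\<lambda>k. if k \<in> {1..m} then \<beta> (\<alpha> k) else 0)"

text \<open>An FI-module over the commutative ring 'r is given by R-submodules V n (the module V([n]))
  of an ambient 'r-module (type 'v with scalar multiplication s), and for each
  \<alpha> : [m] -> [n] in FI a linear map act m n \<alpha> : V m -> V n, functorially.\<close>

definition fi_module ::
  "('r::comm_ring_1 \<Rightarrow> 'v::ab_group_add \<Rightarrow> 'v) \<Rightarrow> (nat \<Rightarrow> 'v set)
    \<Rightarrow> (nat \<Rightarrow> nat \<Rightarrow> (nat \<Rightarrow> nat) \<Rightarrow> 'v \<Rightarrow> 'v) \<Rightarrow> bool" where
  "fi_module s V act \<longleftrightarrow>
     module s \<and>
     (\<forall>n. module.subspace s (V n)) \<and>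
     (\<forall>m n \<alpha>. \<alpha> \<in> FI_hom m n \<longrightarrow>
        (\<forall>x\<in>V m. act m n \<alpha> x \<in> V n) \<and>
        (\<forall>x\<in>V m. \<forall>y\<in>V m. act m n \<alpha> (x + y) = act m n \<alpha> x + act m n \<alpha> y) \<and>
        (\<forall>r. \<forall>x\<in>V m. act m n \<alpha> (s r x) = s r (act m n \<alpha> x))) \<and>
     (\<forall>n. \<forall>x\<in>V n. act n n (FI_id n) x = x) \<and>
     (\<forall>m n p \<alpha> \<beta>. \<alpha> \<in> FI_hom m n \<longrightarrow> \<beta> \<in> FI_hom n p \<longrightarrow>
        (\<forall>x\<in>V m. act m p (FI_comp m \<beta> \<alpha>) x = act n p \<beta> (act m n \<alpha> x)))"

definition fi_morphism ::
  "('r::comm_ring_1 \<Rightarrow> 'v::ab_group_add \<Rightarrow> 'v) \<Rightarrow> (nat \<Rightarrow> 'v set) \<Rightarrow> (nat \<Rightarrow> nat \<Rightarrow> (nat \<Rightarrow> nat) \<Rightarrow> 'v \<Rightarrow> 'v)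
   \<Rightarrow> ('r \<Rightarrow> 'w::ab_group_add \<Rightarrow> 'w) \<Rightarrow> (nat \<Rightarrow> 'w set) \<Rightarrow> (nat \<Rightarrow> nat \<Rightarrow> (nat \<Rightarrow> nat) \<Rightarrow> 'w \<Rightarrow> 'w)
   \<Rightarrow> (nat \<Rightarrow> 'v \<Rightarrow> 'w) \<Rightarrow> bool" where
  "fi_morphism s V act t W bct f \<longleftrightarrow>
     (\<forall>n. \<forall>x\<in>V n. f n x \<in> W n) \<and>
     (\<forall>n. \<forall>x\<in>V n. \<forall>y\<in>V n. f n (x + y) = f n x + f n y) \<and>
     (\<forall>n r. \<forall>x\<in>V n. f n (s r x) = t r (f n x)) \<and>
     (\<forall>m n \<alpha>. \<alpha> \<in> FI_hom m n \<longrightarrow> (\<forall>x\<in>V m. f n (act m n \<alpha> x) = bct m n \<alpha> (f m x)))"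

definition fi_fin_gen ::
  "('r::comm_ring_1 \<Rightarrow> 'v::ab_group_add \<Rightarrow> 'v) \<Rightarrow> (nat \<Rightarrow> 'v set)
    \<Rightarrow> (nat \<Rightarrow> nat \<Rightarrow> (nat \<Rightarrow> nat) \<Rightarrow> 'v \<Rightarrow> 'v) \<Rightarrow> bool" where
  "fi_fin_gen s V act \<longleftrightarrow>
     (\<exists>G :: (nat \<times> 'v) set. finite G \<and> (\<forall>(m, v)\<in>G. v \<in> V m) \<and>
        (\<forall>n. V n = module.span s {act m n \<alpha> v | m v \<alpha>. (m, v) \<in> G \<and> \<alpha> \<in> FI_hom m n}))"

definition fi_free ::
  "('r::comm_ring_1 \<Rightarrow> 'v::ab_group_add \<Rightarrow> 'v) \<Rightarrow> (nat \<Rightarrow> 'v set)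
    \<Rightarrow> (nat \<Rightarrow> nat \<Rightarrow> (nat \<Rightarrow> nat) \<Rightarrow> 'v \<Rightarrow> 'v) \<Rightarrow> bool" where
  "fi_free s V act \<longleftrightarrow>
     (\<exists>B :: nat \<Rightarrow> 'v set. (\<forall>m. B m \<subseteq> V m) \<and>
        (\<forall>n. let I = {(m, \<alpha>, b). m \<le> n \<and> \<alpha> \<in> FI_hom m n \<and> b \<in> B m} in
           V n = {(\<Sum>i\<in>S. s (c i) (case i of (m, \<alpha>, b) \<Rightarrow> act m n \<alpha> b)) | S c. finite S \<and> S \<subseteq> I} \<and>
           (\<forall>S c. finite S \<longrightarrow> S \<subseteq> I \<longrightarrow>
              (\<Sum>i\<in>S. s (c i) (case i of (m, \<alpha>, b) \<Rightarrow> act m n \<alpha> b)) = 0 \<longrightarrow> (\<forall>i\<in>S. c i = 0))))"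

definition fi_free_resolution ::
  "('r::comm_ring_1 \<Rightarrow> 'v::ab_group_add \<Rightarrow> 'v) \<Rightarrow> (nat \<Rightarrow> 'v set) \<Rightarrow> (nat \<Rightarrow> nat \<Rightarrow> (nat \<Rightarrow> nat) \<Rightarrow> 'v \<Rightarrow> 'v)
   \<Rightarrow> ('r \<Rightarrow> 'p::ab_group_add \<Rightarrow> 'p) \<Rightarrow> (nat \<Rightarrow> nat \<Rightarrow> 'p set)
   \<Rightarrow> (nat \<Rightarrow> nat \<Rightarrow> nat \<Rightarrow> (nat \<Rightarrow> nat) \<Rightarrow> 'p \<Rightarrow> 'p)
   \<Rightarrow> (nat \<Rightarrow> nat \<Rightarrow> 'p \<Rightarrow> 'p) \<Rightarrow> (nat \<Rightarrow> 'p \<Rightarrow> 'v) \<Rightarrow> bool" where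
  "fi_free_resolution s V act t P pact d eps \<longleftrightarrow>
     (\<forall>a. fi_module t (P a) (pact a) \<and> fi_free t (P a) (pact a)) \<and>
     (\<forall>a. fi_morphism t (P (Suc a)) (pact (Suc a)) t (P a) (pact a) (d (Suc a))) \<and>
     fi_morphism t (P 0) (pact 0) s V act eps \<and>
     (\<forall>n. eps n ` P 0 n = V n) \<and>
     (\<forall>n. {x \<in> P 0 n. eps n x = 0} = d 1 n ` P 1 n) \<and>
     (\<forall>a n. {x \<in> P (Suc a) n. d (Suc a) n x = 0} = d (Suc (Suc a)) n ` P (Suc (Suc a)) n)"

definition fi_J ::
  "('r::comm_ring_1 \<Rightarrow> 'v::ab_group_add \<Rightarrow> 'v) \<Rightarrow> (nat \<Rightarrow> 'v set)
    \<Rightarrow> (nat \<Rightarrow> nat \<Rightarrow> (nat \<Rightarrow> nat) \<Rightarrow> 'v \<Rightarrow> 'v) \<Rightarrow> nat \<Rightarrow> 'v set" where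
  "fi_J s W act n = module.span s {act m n \<alpha> w | m \<alpha> w. m < n \<and> \<alpha> \<in> FI_hom m n \<and> w \<in> W m}"

text \<open>H_a(V) for a \<ge> 1, computed as the left derived functor of W \<mapsto> W/JW via the free
  resolution P: it is the homology at a of the complex P_\<bullet>/JP_\<bullet>.
  fi_homology_nonzero ... a n  says that H_a(V)([n]) \<noteq> 0 (for a = Suc k).\<close>

definition fi_homology_nonzero ::
  "('r::comm_ring_1 \<Rightarrow> 'p::ab_group_add \<Rightarrow> 'p) \<Rightarrow> (nat \<Rightarrow> nat \<Rightarrow> 'p set)
   \<Rightarrow> (nat \<Rightarrow> nat \<Rightarrow> nat \<Rightarrow> (nat \<Rightarrow> nat) \<Rightarrow> 'p \<Rightarrow> 'p) \<Rightarrow> (nat \<Rightarrow> nat \<Rightarrow> 'p \<Rightarrow> 'p)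
   \<Rightarrow> nat \<Rightarrow> nat \<Rightarrow> bool" where
  "fi_homology_nonzero t P pact d k n \<longleftrightarrow>
     (\<exists>x \<in> P (Suc k) n.
        d (Suc k) n x \<in> fi_J t (P k) (pact k) n \<and>
        x \<notin> {y + z | y z. y \<in> d (Suc (Suc k)) n ` P (Suc (Suc k)) n \<and> z \<in> fi_J t (P (Suc k)) (pact (Suc k)) n})"

text \<open>Degree of H_a(V) for a = Suc k, and of an FI-module V (sup of the empty set is -\<infinity>).\<close>

definition fi_homology_deg ::
  "('r::comm_ring_1 \<Rightarrow> 'p::ab_group_add \<Rightarrow> 'p) \<Rightarrow> (nat \<Rightarrow> nat \<Rightarrow> 'p set)
   \<Rightarrow> (nat \<Rightarrow> nat \<Rightarrow> nat \<Rightarrow> (nat \<Rightarrow> nat) \<Rightarrow> 'p \<Rightarrow> 'p) \<Rightarrow> (nat \<Rightarrow> nat \<Rightarrow> 'p \<Rightarrow> 'p)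
   \<Rightarrow> nat \<Rightarrow> ereal" where
  "fi_homology_deg t P pact d k = Sup {ereal (real n) | n. fi_homology_nonzero t P pact d k n}"

definition fi_deg :: "(nat \<Rightarrow> 'v::zero set) \<Rightarrow> ereal" where
  "fi_deg V = Sup {ereal (real n) | n. V n \<noteq> {0}}"

text \<open>Castelnuovo-Mumford regularity, computed from a free resolution P of V:
  inf of all integers c with deg H_a(V) \<le> c + a for all a \<ge> 1 (inf of empty set is \<infinity>).\<close>

definition fi_reg ::
  "('r::comm_ring_1 \<Rightarrow> 'p::ab_group_add \<Rightarrow> 'p) \<Rightarrow> (nat \<Rightarrow> nat \<Rightarrow> 'p set)
   \<Rightarrow> (nat \<Rightarrow> nat \<Rightarrow> nat \<Rightarrow> (nat \<Rightarrow> nat) \<Rightarrow> 'p \<Rightarrow> 'p) \<Rightarrow> (nat \<Rightarrow> nat \<Rightarrow> 'p \<Rightarrow> 'p) \<Rightarrow> ereal" where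
  "fi_reg t P pact d =
     Inf {ereal (real_of_int c) | c :: int.
            \<forall>k. fi_homology_deg t P pact d k \<le> ereal (real_of_int c) + ereal (real (Suc k))}"

end

theory Submission
  imports Defs
begin

text \<open>FI-homology is computed by the Koszul complex \<open>K\<^sub>a(V)([n]) = \<Oplus> V([n] - T)\<close>, the sum being over
  \<open>T \<subseteq> [n]\<close> with \<open>|T| = a\<close>: this complex is exact in \<open>V\<close>, the cokernel of its last differential is
  \<open>V/JV\<close>, and for free \<open>V\<close> it splits into complexes of simplices, which are acyclic in positive degrees.
  Dimension shifting along the syzygies of a free resolution then identifies its homology
  with \<open>H\<^sub>a\<close>.

  If \<open>V\<close> has degree \<open>D\<close>, then \<open>K\<^sub>a(V)([n]) = 0\<close> for \<open>n > D + a\<close>, which bounds the regularity by \<open>D\<close>.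
  Conversely, \<open>H\<^sub>a\<close> is nonzero at \<open>[D + a]\<close> for \<open>a = D + 1\<close>: every chain is a cycle there, and an
  alternating sum over the transversals of \<open>D\<close> disjoint pairs in \<open>[2D + 1]\<close> maps chains onto
  \<open>V([D])\<close> and kills all boundaries.\<close>

section \<open>Positions in finite sets\<close>

definition pos :: "nat set \<Rightarrow> nat \<Rightarrow> nat" where
  "pos S x = card {y \<in> S. y \<le> x}"

text \<open>The increasing injection of \<open>[m]\<close> into \<open>[m + 1]\<close> that skips
  the value \<open>i\<close>, for 1 \<le> i \<le> m + 1; the value 0 off \<open>{1..m}\<close> makes
  it the representative chosen in \<open>FI_hom\<close>.\<close>

definition coface :: "nat \<Rightarrow> nat \<Rightarrow> nat \<Rightarrow> nat" where
  "coface m i k = (if k \<in> {1..m} then if k < i then k else Suc k else 0)"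

lemma pos_mem:
  assumes "finite S" "x \<in> S" shows "pos S x \<in> {1..card S}"
proof -
  have "{y \<in> S. y \<le> x} \<noteq> {}" using assms by auto
  then have "pos S x \<noteq> 0" using assms unfolding pos_def by simp
  moreover have "pos S x \<le> card S" unfolding pos_def using assms by (intro card_mono) auto
  ultimately show ?thesis by simp
qed

lemma pos_less:
  assumes "finite S" "y \<in> S" "x < y" shows "pos S x < pos S y"
proof -
  have "{z \<in> S. z \<le> x} \<subset> {z \<in> S. z \<le> y}"
  proof (intro psubsetI notI)
    assume eq: "{z \<in> S. z \<le> x} = {z \<in> S. z \<le> y}"
    have "y \<in> {z \<in> S. z \<le> y}" using assms by simp
    then show False using assms(3) unfolding eq[symmetric] by simp
  qed (use assms in auto)
  then show ?thesis unfolding pos_def using assms(1) by (intro psubset_card_mono) auto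
qed

lemma inj_on_pos: "finite S \<Longrightarrow> inj_on (pos S) S"
  by (rule linorder_inj_onI) (auto dest: pos_less)

lemma pos_image:
  assumes "finite S" shows "pos S ` S = {1..card S}"
  using assms inj_on_pos[OF assms] pos_mem[OF assms]
  by (intro card_subset_eq) (auto simp: card_image)

lemma pos_remove:
  assumes "finite S" "x \<in> S"
  shows "pos S y = pos (S - {x}) y + (if x \<le> y then 1 else 0)"
proof (cases "x \<le> y")
  case True
  then have "{z \<in> S. z \<le> y} = insert x {z \<in> S - {x}. z \<le> y}" using assms by auto
  then show ?thesis using True assms by (simp add: pos_def)
next
  case False
  then have "{z \<in> S. z \<le> y} = {z \<in> S - {x}. z \<le> y}" by auto
  then show ?thesis using False by (simp add: pos_def)
qed

text \<open>Removing \<open>x\<close> lowers by one the positions of exactly the elements of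
  \<open>S\<close> above \<open>x\<close>. So the inclusion of \<open>S - {x}\<close> into
  \<open>S\<close>, read through the bijections \<open>pos\<close>, is this coface.\<close>

lemma coface_pos:
  assumes "finite S" "x \<in> S" "y \<in> S - {x}"
  shows "coface (card S - 1) (pos S x) (pos (S - {x}) y) = pos S y"
proof -
  have "pos (S - {x}) y \<in> {1..card S - 1}" using pos_mem[of "S - {x}" y] assms by simp
  moreover have "pos S x < pos S y" if "x < y" using pos_less assms that by auto
  moreover have "pos S y < pos S x" if "y < x" using pos_less assms that by auto
  moreover note pos_remove[OF assms(1,2), of y]
  ultimately show ?thesis using assms(3) unfolding coface_def
    by (cases "x < y") (auto split: if_splits)
qed

lemma coface_in_FI_hom:
  assumes "1 \<le> i" shows "coface m i \<in> FI_hom m (Suc m)"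
  using assms unfolding FI_hom_def coface_def by (auto simp: inj_on_def)

section \<open>The Koszul complex of an FI-module\<close>

text \<open>The usual sign \<open>(-1)^(x - pos S x)\<close> counts the elements below \<open>x\<close> in the complement of \<open>S\<close>;
  multiplying the component at \<open>S\<close> by \<open>(-1)^(\<Sum>S)\<close> turns it into this one.\<close>

definition ksgn :: "nat set \<Rightarrow> nat \<Rightarrow> 'r::comm_ring_1" where
  "ksgn S x = (-1) ^ pos S x"

lemma ksgn_square: "ksgn S x * ksgn S x = (1 :: 'r::comm_ring_1)"
  by (simp add: ksgn_def flip: power_mult_distrib)

text \<open>Removing the smaller of the two elements lowers the position of the larger by one, while
  removing the larger leaves the smaller in place; the two products differ by one factor -1.\<close>

lemma ksgn_swap:
  assumes "finite S" "x \<in> S" "y \<in> S" "x \<noteq> y"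
  shows "ksgn S x * ksgn (S - {x}) y = - (ksgn S y * ksgn (S - {y}) x :: 'r::comm_ring_1)"
  using pos_remove[OF assms(1,2), of y] pos_remove[OF assms(1,3), of x] assms(4)
  unfolding ksgn_def by (cases "x < y") auto

text \<open>The induction cancels the pairs through the new element. Observing that the sum equals
  its own negative would not do, since the group may have 2-torsion.\<close>

lemma sum_antisym_pairs:
  fixes A :: "'i \<Rightarrow> 'i \<Rightarrow> 'a::ab_group_add"
  assumes "finite S" "\<And>x y. x \<in> S \<Longrightarrow> y \<in> S \<Longrightarrow> x \<noteq> y \<Longrightarrow> A x y = - A y x"
  shows "(\<Sum>x\<in>S. \<Sum>y\<in>S - {x}. A x y) = 0"
  using assms
proof (induction S)
  case (insert z S)
  have IH: "(\<Sum>x\<in>S. \<Sum>y\<in>S - {x}. A x y) = 0"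
    by (rule insert.IH) (rule insert.prems; simp)
  have "(\<Sum>y\<in>insert z S - {x}. A x y) = A x z + (\<Sum>y\<in>S - {x}. A x y)" if "x \<in> S" for x
  proof -
    have "insert z S - {x} = insert z (S - {x})" "z \<notin> S - {x}" using insert.hyps that by auto
    then show ?thesis using insert.hyps(1) by simp
  qed
  then have "(\<Sum>x\<in>S. \<Sum>y\<in>insert z S - {x}. A x y) = (\<Sum>x\<in>S. A x z)"
    by (simp add: sum.distrib IH)
  also have "\<dots> = (\<Sum>x\<in>S. - A z x)"
  proof (rule sum.cong)
    fix x assume "x \<in> S"
    then show "A x z = - A z x" using insert.hyps by (intro insert.prems) auto
  qed simp
  finally have "(\<Sum>x\<in>S. \<Sum>y\<in>insert z S - {x}. A x y) = - (\<Sum>x\<in>S. A z x)"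
    by (simp only: sum_negf)
  moreover have "insert z S - {z} = S" using insert.hyps by auto
  ultimately show ?case unfolding sum.insert[OF insert.hyps(1,2)] by simp
next
  case empty
  show ?case by (rule sum.empty)
qed

text \<open>The contracting homotopy inserts \<open>x0\<close>; it preserves the property of vanishing at all sets not
  containing a given set \<open>F\<close>, provided that \<open>x0 \<notin> F\<close>.\<close>

lemma scalar_koszul_exact:
  fixes f :: "nat set \<Rightarrow> 'r::comm_ring_1"
  assumes x0: "x0 \<in> {1..n}"
    and cyc: "\<And>S. S \<subseteq> {1..n} \<Longrightarrow> (\<Sum>x\<in>S. ksgn S x * f (S - {x})) = 0"
    and S: "S \<subseteq> {1..n}"
  defines "g \<equiv> \<lambda>S. if x0 \<in> S then 0 else ksgn (insert x0 S) x0 * f (insert x0 S)"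
  shows "f S = (\<Sum>x\<in>S. ksgn S x * g (S - {x}))"
proof (cases "x0 \<in> S")
  case True
  have fin: "finite S" using S finite_subset by blast
  have "(\<Sum>x\<in>S - {x0}. ksgn S x * g (S - {x})) = 0"
    using True by (intro sum.neutral) (auto simp: g_def)
  then have "(\<Sum>x\<in>S. ksgn S x * g (S - {x})) = ksgn S x0 * g (S - {x0})"
    using fin True by (simp add: sum.remove)
  also have "\<dots> = f S" using True
    by (simp add: g_def insert_absorb ksgn_square flip: mult.assoc)
  finally show ?thesis by simp
next
  case False
  have fin: "finite S" using S finite_subset by blast
  let ?S = "insert x0 S"
  \<comment> \<open>The cycle condition at \<open>insert x0 S\<close> can be solved for
    \<open>f S\<close>, whose coefficient is a sign; the other terms are values of \<open>f\<close>
    at sets containing \<open>x0\<close>, hence values of \<open>g\<close> up to sign.\<close>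
  have "0 = (\<Sum>x\<in>?S. ksgn ?S x * f (?S - {x}))" using cyc[of ?S] S x0 by simp
  also have "\<dots> = ksgn ?S x0 * f S + (\<Sum>x\<in>S. ksgn ?S x * f (?S - {x}))"
    using fin False by simp
  finally have "ksgn ?S x0 * f S = - (\<Sum>x\<in>S. ksgn ?S x * f (?S - {x}))"
    by (simp add: eq_neg_iff_add_eq_0)
  then have "ksgn ?S x0 * (ksgn ?S x0 * f S) = - (\<Sum>x\<in>S. ksgn ?S x0 * (ksgn ?S x * f (?S - {x})))"
    by (simp add: sum_distrib_left)
  then have "f S = - (\<Sum>x\<in>S. ksgn ?S x0 * (ksgn ?S x * f (?S - {x})))"
    by (simp add: ksgn_square flip: mult.assoc)
  also have "\<dots> = (\<Sum>x\<in>S. ksgn S x * g (S - {x}))"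
    unfolding sum_negf[symmetric]
  proof (rule sum.cong)
    fix x assume x: "x \<in> S"
    have eq: "?S - {x0} = S" "?S - {x} = insert x0 (S - {x})" using False x by auto
    have "ksgn ?S x0 * ksgn S x = - (ksgn ?S x * ksgn (?S - {x}) x0 :: 'r)"
      using ksgn_swap[of ?S x0 x] fin x False eq by auto
    then have "ksgn ?S x0 * (ksgn ?S x0 * ksgn S x) = - (ksgn ?S x0 * (ksgn ?S x * ksgn (?S - {x}) x0) :: 'r)"
      by simp
    then have sw: "ksgn S x = - (ksgn ?S x0 * (ksgn ?S x * ksgn (?S - {x}) x0) :: 'r)"
      by (simp add: ksgn_square flip: mult.assoc)
    have "ksgn S x * g (S - {x}) = ksgn S x * (ksgn (?S - {x}) x0 * f (?S - {x}))"
      using False x eq by (simp add: g_def)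
    also have "\<dots> = - (ksgn ?S x0 * (ksgn ?S x * (ksgn (?S - {x}) x0 * ksgn (?S - {x}) x0) * f (?S - {x})))"
      by (simp add: sw mult.assoc)
    finally show "- (ksgn ?S x0 * (ksgn ?S x * f (?S - {x}))) = ksgn S x * g (S - {x})"
      by (simp add: ksgn_square)
  qed simp
  finally show ?thesis .
qed

text \<open>The map induced by the inclusion of \<open>S - {x}\<close> into \<open>S\<close>,
  transported along \<open>pos\<close> and signed: the component of the differential from the
  summand at \<open>S - {x}\<close> to the one at \<open>S\<close>.\<close>

definition kface :: "('r::comm_ring_1 \<Rightarrow> 'v::ab_group_add \<Rightarrow> 'v)
    \<Rightarrow> (nat \<Rightarrow> nat \<Rightarrow> (nat \<Rightarrow> nat) \<Rightarrow> 'v \<Rightarrow> 'v) \<Rightarrow> nat set \<Rightarrow> nat \<Rightarrow> 'v \<Rightarrow> 'v" where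
  "kface s act S x v =
     s (ksgn S x) (act (card S - 1) (card S) (coface (card S - 1) (pos S x)) v)"

text \<open>The cut-off keeps boundaries inside \<open>kchains\<close>: a set with a single element
  outside \<open>{1..n}\<close> could otherwise receive a nonzero value.\<close>

definition kbd :: "('r::comm_ring_1 \<Rightarrow> 'v::ab_group_add \<Rightarrow> 'v)
    \<Rightarrow> (nat \<Rightarrow> nat \<Rightarrow> (nat \<Rightarrow> nat) \<Rightarrow> 'v \<Rightarrow> 'v) \<Rightarrow> nat \<Rightarrow> (nat set \<Rightarrow> 'v) \<Rightarrow> nat set \<Rightarrow> 'v" where
  "kbd s act n w S = (if S \<subseteq> {1..n} then \<Sum>x\<in>S. kface s act S x (w (S - {x})) else 0)"

text \<open>Degree \<open>a\<close> of the Koszul complex at \<open>[n]\<close> is the sum of \<open>V([n] - T)\<close> over the subsets \<open>T\<close> of size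
  \<open>a\<close>. It is indexed here by the complements \<open>S\<close>, and \<open>V(S)\<close> is identified with \<open>V([card S])\<close> along
  the increasing bijection \<open>pos S\<close>.\<close>

definition kchains :: "(nat \<Rightarrow> 'v::zero set) \<Rightarrow> nat \<Rightarrow> nat \<Rightarrow> (nat set \<Rightarrow> 'v) set" where
  "kchains V a n = {w. \<forall>S. if S \<subseteq> {1..n} \<and> card S + a = n then w S \<in> V (card S) else w S = 0}"

definition kexact :: "('r::comm_ring_1 \<Rightarrow> 'v::ab_group_add \<Rightarrow> 'v) \<Rightarrow> (nat \<Rightarrow> 'v set)
    \<Rightarrow> (nat \<Rightarrow> nat \<Rightarrow> (nat \<Rightarrow> nat) \<Rightarrow> 'v \<Rightarrow> 'v) \<Rightarrow> nat \<Rightarrow> nat \<Rightarrow> bool" where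
  "kexact s V act a n \<longleftrightarrow>
     (\<forall>w\<in>kchains V a n. kbd s act n w = (\<lambda>_. 0) \<longrightarrow> (\<exists>u\<in>kchains V (Suc a) n. w = kbd s act n u))"

section \<open>The Koszul differential squares to zero\<close>

locale fi_mod = module s
  for s :: "'r::comm_ring_1 \<Rightarrow> 'v::ab_group_add \<Rightarrow> 'v" +
  fixes V :: "nat \<Rightarrow> 'v set" and act :: "nat \<Rightarrow> nat \<Rightarrow> (nat \<Rightarrow> nat) \<Rightarrow> 'v \<Rightarrow> 'v"
  assumes fi_module: "fi_module s V act"

lemma fi_modI: "fi_module s V act \<Longrightarrow> fi_mod s V act"
  unfolding fi_mod_def fi_mod_axioms_def by (auto simp: fi_module_def)

context fi_mod
begin

lemma subspace_V: "subspace (V n)"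
  using fi_module by (simp add: fi_module_def)

lemmas V_0 = subspace_0[OF subspace_V]
  and V_add = subspace_add[OF subspace_V]
  and V_diff = subspace_diff[OF subspace_V]
  and V_scale = subspace_scale[OF subspace_V]
  and V_sum = subspace_sum[OF subspace_V]

lemma act_closed: "\<alpha> \<in> FI_hom m n \<Longrightarrow> x \<in> V m \<Longrightarrow> act m n \<alpha> x \<in> V n"
  and act_add: "\<alpha> \<in> FI_hom m n \<Longrightarrow> x \<in> V m \<Longrightarrow> y \<in> V m
    \<Longrightarrow> act m n \<alpha> (x + y) = act m n \<alpha> x + act m n \<alpha> y"
  and act_scale: "\<alpha> \<in> FI_hom m n \<Longrightarrow> x \<in> V m \<Longrightarrow> act m n \<alpha> (s r x) = s r (act m n \<alpha> x)"
  and act_comp: "\<alpha> \<in> FI_hom m n \<Longrightarrow> \<beta> \<in> FI_hom n p \<Longrightarrow> x \<in> V m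
    \<Longrightarrow> act m p (FI_comp m \<beta> \<alpha>) x = act n p \<beta> (act m n \<alpha> x)"
  using fi_module by (simp_all add: fi_module_def)

lemma coface_hom:
  assumes "finite S" "x \<in> S"
  shows "coface (card S - 1) (pos S x) \<in> FI_hom (card S - 1) (card S)"
proof -
  have "Suc (card S - 1) = card S" using assms by (metis card_gt_0_iff Suc_diff_1 empty_iff)
  then show ?thesis using coface_in_FI_hom[of "pos S x" "card S - 1"] pos_mem[OF assms] by simp
qed

context
  fixes S :: "nat set" and x :: nat
  assumes Sx: "finite S" "x \<in> S"
begin

lemma kface_closed: "v \<in> V (card S - 1) \<Longrightarrow> kface s act S x v \<in> V (card S)"
  unfolding kface_def using act_closed coface_hom[OF Sx] V_scale by blast

lemma kface_add: "v \<in> V (card S - 1) \<Longrightarrow> w \<in> V (card S - 1)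
    \<Longrightarrow> kface s act S x (v + w) = kface s act S x v + kface s act S x w"
  unfolding kface_def using act_add coface_hom[OF Sx] by (simp add: scale_right_distrib)

lemma kface_scale: "v \<in> V (card S - 1) \<Longrightarrow> kface s act S x (s r v) = s r (kface s act S x v)"
  unfolding kface_def using act_scale coface_hom[OF Sx] by (simp add: mult.commute)

lemma kface_0: "kface s act S x 0 = 0"
  using kface_scale[OF V_0, of 0] by simp

lemma kface_sum: "(\<And>i. i \<in> I \<Longrightarrow> f i \<in> V (card S - 1))
    \<Longrightarrow> kface s act S x (sum f I) = (\<Sum>i\<in>I. kface s act S x (f i))"
  by (induction I rule: infinite_finite_induct) (simp_all add: kface_0 kface_add V_sum)

end

text \<open>Both composites come from the inclusion of \<open>S - {x, y}\<close> into
  \<open>S\<close>, so they agree up to sign, and \<open>ksgn_swap\<close> supplies the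
  sign.\<close>

lemma kface_kface:
  assumes fin: "finite S" and x: "x \<in> S" and y: "y \<in> S" and xy: "x \<noteq> y"
    and v: "v \<in> V (card S - 2)"
  shows "kface s act S x (kface s act (S - {x}) y v) = - kface s act S y (kface s act (S - {y}) x v)"
proof -
  let ?c = "\<lambda>x y. FI_comp (card S - 2) (coface (card S - 1) (pos S x))
      (coface (card S - 2) (pos (S - {x}) y))"
  have card: "card (S - {x}) = card S - 1" "card (S - {x}) - 1 = card S - 2" if "x \<in> S" for x
    using fin that by auto
  have hom: "coface (card S - 2) (pos (S - {x}) y) \<in> FI_hom (card S - 2) (card S - 1)"
    if "x \<in> S" "y \<in> S" "x \<noteq> y" for x y
    using coface_hom[of "S - {x}" y] fin that card by simp
  have expand: "kface s act S x (kface s act (S - {x}) y v)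
      = s (ksgn S x * ksgn (S - {x}) y) (act (card S - 2) (card S) (?c x y) v)"
    if "x \<in> S" "y \<in> S" "x \<noteq> y" for x y
    using card[OF that(1)] that hom[OF that] coface_hom[OF fin that(1)] v act_closed
    by (simp add: kface_def act_scale act_comp)
  have val: "?c x y (pos (S - {x} - {y}) z) = pos S z"
    if "x \<in> S" "y \<in> S" "x \<noteq> y" "z \<in> S - {x} - {y}" for x y z
  proof -
    have "pos (S - {x} - {y}) z \<in> {1..card S - 2}"
      using pos_mem[of "S - {x} - {y}" z] fin that by (simp add: numeral_2_eq_2)
    then show ?thesis
      using coface_pos[of "S - {x}" y z] coface_pos[of S x z] fin that card[OF that(1)]
      by (simp add: FI_comp_def)
  qed
  have "?c x y = ?c y x"
  proof
    fix k show "?c x y k = ?c y x k"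
    proof (cases "k \<in> {1..card S - 2}")
      case True
      moreover have "card (S - {x} - {y}) = card S - 2" using fin x y xy by simp
      ultimately have "k \<in> pos (S - {x} - {y}) ` (S - {x} - {y})"
        using pos_image[of "S - {x} - {y}"] fin by simp
      then obtain z where z: "z \<in> S - {x} - {y}" "k = pos (S - {x} - {y}) z" by blast
      moreover have "S - {x} - {y} = S - {y} - {x}" by auto
      ultimately show ?thesis using val[of x y z] val[of y x z] x y xy by auto
    qed (auto simp: FI_comp_def)
  qed
  then show ?thesis
    using expand[OF x y xy] expand[OF y x xy[symmetric]] ksgn_swap[OF fin x y xy, where ?'r = 'r]
    by simp
qed

lemma kchains_closed: "w \<in> kchains V a n \<Longrightarrow> S \<subseteq> {1..n} \<Longrightarrow> w S \<in> V (card S)"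
  unfolding kchains_def using V_0 by (auto split: if_splits)

lemma kchains_remove:
  assumes "w \<in> kchains V a n" "S \<subseteq> {1..n}" "x \<in> S"
  shows "w (S - {x}) \<in> V (card S - 1)"
  using kchains_closed[OF assms(1), of "S - {x}"] assms by (simp add: Diff_subset subset_trans[OF Diff_subset])

lemma kbd_closed:
  assumes w: "w \<in> kchains V (Suc a) n" shows "kbd s act n w \<in> kchains V a n"
  unfolding kchains_def
proof (intro CollectI allI)
  fix S
  show "if S \<subseteq> {1..n} \<and> card S + a = n then kbd s act n w S \<in> V (card S) else kbd s act n w S = 0"
  proof (cases "S \<subseteq> {1..n}")
    case True
    then have fin: "finite S" using finite_subset by blast
    have "w (S - {x}) = 0" if "x \<in> S" "card S + a \<noteq> n" for x
    proof -
      have "card S \<noteq> 0" using that fin by auto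
      then have "card (S - {x}) + Suc a = card S + a"
        using card.remove[OF fin that(1)] by simp
      then have "card (S - {x}) + Suc a \<noteq> n" using that by simp
      then show ?thesis using w unfolding kchains_def by (auto split: if_splits)
    qed
    then have "kbd s act n w S = 0" if "card S + a \<noteq> n"
      using that fin by (simp add: kbd_def kface_0)
    moreover have "kbd s act n w S \<in> V (card S)"
      using True fin kchains_remove[OF w True] by (auto simp: kbd_def intro!: V_sum kface_closed)
    ultimately show ?thesis using True by auto
  qed (simp add: kbd_def)
qed

lemma kbd_add:
  assumes "u \<in> kchains V a n" "w \<in> kchains V a n"
  shows "kbd s act n (\<lambda>S. u S + w S) = (\<lambda>S. kbd s act n u S + kbd s act n w S)"
proof
  fix S show "kbd s act n (\<lambda>S. u S + w S) S = kbd s act n u S + kbd s act n w S"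
    using kchains_remove[OF assms(1), of S] kchains_remove[OF assms(2), of S]
    by (auto simp: kbd_def sum.distrib[symmetric] kface_add finite_subset[of S "{1..n}"]
        intro!: sum.cong)
qed

lemma kchains_diff:
  "u \<in> kchains V a n \<Longrightarrow> w \<in> kchains V a n \<Longrightarrow> (\<lambda>S. u S - w S) \<in> kchains V a n"
  unfolding kchains_def using V_diff by (auto split: if_splits)

lemma kbd_diff:
  assumes "u \<in> kchains V a n" "w \<in> kchains V a n"
  shows "kbd s act n (\<lambda>S. u S - w S) = (\<lambda>S. kbd s act n u S - kbd s act n w S)"
  using kbd_add[OF kchains_diff[OF assms] assms(2)] by (auto simp: fun_eq_iff eq_diff_eq)

lemma kbd_kbd:
  assumes w: "w \<in> kchains V a n" shows "kbd s act n (kbd s act n w) = (\<lambda>_. 0)"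
proof
  fix S
  show "kbd s act n (kbd s act n w) S = 0"
  proof (cases "S \<subseteq> {1..n}")
    case S: True
    then have fin: "finite S" using finite_subset by blast
    let ?A = "\<lambda>x y. kface s act S x (kface s act (S - {x}) y (w (S - {x} - {y})))"
    have mem: "w (S - {x} - {y}) \<in> V (card S - 2)" if "x \<in> S" "y \<in> S - {x}" for x y
      using kchains_remove[OF w, of "S - {x}" y] that S fin by (auto simp: numeral_2_eq_2)
    have "kbd s act n (kbd s act n w) S = (\<Sum>x\<in>S. \<Sum>y\<in>S - {x}. ?A x y)"
    proof -
      have "kface s act S x (kbd s act n w (S - {x})) = (\<Sum>y\<in>S - {x}. ?A x y)" if x: "x \<in> S" for x
      proof -
        have "kface s act (S - {x}) y (w (S - {x} - {y})) \<in> V (card S - 1)" if "y \<in> S - {x}" for y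
          using kface_closed[of "S - {x}" y] mem[OF x that] fin that x
          by (simp add: numeral_2_eq_2)
        moreover have "S - {x} \<subseteq> {1..n}" using S by auto
        ultimately show ?thesis
          using kface_sum[OF fin x, of "S - {x}" "\<lambda>y. kface s act (S - {x}) y (w (S - {x} - {y}))"]
          by (simp add: kbd_def)
      qed
      then have "(\<Sum>x\<in>S. kface s act S x (kbd s act n w (S - {x}))) = (\<Sum>x\<in>S. \<Sum>y\<in>S - {x}. ?A x y)"
        by (rule sum.cong[OF refl])
      moreover have "kbd s act n (kbd s act n w) S = (\<Sum>x\<in>S. kface s act S x (kbd s act n w (S - {x})))"
        using S by (subst kbd_def) simp
      ultimately show ?thesis by simp
    qed
    also have "\<dots> = 0"
    proof (rule sum_antisym_pairs[OF fin])
      fix x y assume xy: "x \<in> S" "y \<in> S" "x \<noteq> y"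
      moreover have "S - {x} - {y} = S - {y} - {x}" by auto
      ultimately show "?A x y = - ?A y x"
        using kface_kface[OF fin xy mem] by auto
    qed
    finally show ?thesis .
  qed (simp add: kbd_def)
qed

end

lemma kchains_outside:
  "w \<in> kchains V a n \<Longrightarrow> \<not> (S \<subseteq> {1..n} \<and> card S + a = n) \<Longrightarrow> w S = 0"
  unfolding kchains_def by (drule CollectD, drule spec[of _ S]) (simp only: if_False)

lemma kchains_0_outside:
  assumes "w \<in> kchains V 0 n" "S \<noteq> {1..n}" shows "w S = 0"
  using card_subset_eq[of "{1..n}" S] assms(2) by (intro kchains_outside[OF assms(1)]) auto

lemma kchains_0_eqI:
  assumes "u \<in> kchains X 0 n" "w \<in> kchains Y 0 n" "u {1..n} = w {1..n}"
  shows "u = w"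
proof
  fix S show "u S = w S"
    using kchains_0_outside[OF assms(1), of S] kchains_0_outside[OF assms(2), of S] assms(3)
    by (cases "S = {1..n}") simp_all
qed

section \<open>The cokernel of the last differential\<close>

context fi_mod
begin

lemma kbd_scale:
  assumes "u \<in> kchains V a n"
  shows "kbd s act n (\<lambda>S. s r (u S)) = (\<lambda>S. s r (kbd s act n u S))"
proof
  fix S show "kbd s act n (\<lambda>S. s r (u S)) S = s r (kbd s act n u S)"
    using kchains_remove[OF assms, of S]
    by (auto simp: kbd_def scale_sum_right kface_scale finite_subset[of S "{1..n}"] intro!: sum.cong)
qed

lemma kchains_zero: "(\<lambda>_. 0) \<in> kchains V a n"
  unfolding kchains_def by (simp add: V_0)

lemma kchains_add:
  "u \<in> kchains V a n \<Longrightarrow> w \<in> kchains V a n \<Longrightarrow> (\<lambda>S. u S + w S) \<in> kchains V a n"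
  unfolding kchains_def using V_add by (auto split: if_splits)

lemma kchains_scale: "u \<in> kchains V a n \<Longrightarrow> (\<lambda>S. s r (u S)) \<in> kchains V a n"
  unfolding kchains_def using V_scale by (auto split: if_splits)

text \<open>As \<open>x\<close> is not a value of \<open>\<alpha>\<close>, lowering the values above
  \<open>x\<close> by one stays injective and lands in \<open>[n - 1]\<close>; the coface raises
  them again.\<close>

lemma FI_hom_factor_coface:
  assumes "\<alpha> \<in> FI_hom m n" "x \<in> {1..n}" "x \<notin> \<alpha> ` {1..m}"
  obtains \<alpha>' where "\<alpha>' \<in> FI_hom m (n - 1)" "\<alpha> = FI_comp m (coface (n - 1) x) \<alpha>'"
proof
  let ?\<alpha>' = "\<lambda>j. if j \<in> {1..m} then if \<alpha> j < x then \<alpha> j else \<alpha> j - 1 else 0"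
  have *: "\<alpha> j \<in> {1..n}" "\<alpha> j \<noteq> x" if "j \<in> {1..m}" for j
    using assms that unfolding FI_hom_def by blast+
  have "inj_on ?\<alpha>' {1..m}"
  proof (rule inj_onI)
    fix i j assume ij: "i \<in> {1..m}" "j \<in> {1..m}" "?\<alpha>' i = ?\<alpha>' j"
    then have "\<alpha> i = \<alpha> j" using *[of i] *[of j] by (auto split: if_splits)
    then show "i = j" using assms(1) ij unfolding FI_hom_def by (auto dest: inj_onD)
  qed
  moreover have "?\<alpha>' j \<in> {1..n - 1}" if "j \<in> {1..m}" for j
    using *[OF that] that assms(2) by auto
  ultimately show "?\<alpha>' \<in> FI_hom m (n - 1)"
    unfolding FI_hom_def by (intro CollectI conjI image_subsetI) simp_all
  show "\<alpha> = FI_comp m (coface (n - 1) x) ?\<alpha>'"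
  proof
    fix j show "\<alpha> j = FI_comp m (coface (n - 1) x) ?\<alpha>' j"
      using *[of j] assms by (cases "j \<in> {1..m}") (auto simp: FI_comp_def coface_def FI_hom_def)
  qed
qed

lemma pos_interval: "x \<in> {1..n} \<Longrightarrow> pos {1..n} x = x"
proof -
  assume "x \<in> {1..n}"
  then have "{y \<in> {1..n}. y \<le> x} = {1..x}" by auto
  then show ?thesis by (simp add: pos_def)
qed

text \<open>A non-surjective morphism into \<open>[n]\<close> factors through a coface from
  \<open>[n - 1]\<close>, so the images of the cofaces already span \<open>JV\<close>. This makes
  \<open>V/JV\<close> the cokernel of the last Koszul differential.\<close>

lemma fi_J_eq: "fi_J s V act n = (\<lambda>u. kbd s act n u {1..n}) ` kchains V (Suc 0) n" (is "_ = ?R")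
proof
  have "subspace ?R"
    unfolding subspace_def
  proof (intro conjI ballI allI)
    show "0 \<in> ?R"
      by (rule image_eqI[OF _ kchains_zero]) (simp add: kbd_def kface_0)
  next
    fix y z assume "y \<in> ?R" "z \<in> ?R"
    then obtain u w where uw: "u \<in> kchains V (Suc 0) n" "w \<in> kchains V (Suc 0) n"
      "y = kbd s act n u {1..n}" "z = kbd s act n w {1..n}" by auto
    then show "y + z \<in> ?R" using kbd_add[OF uw(1,2)]
      by (intro image_eqI[OF _ kchains_add[OF uw(1,2)]]) simp
  next
    fix c y assume "y \<in> ?R"
    then obtain u where u: "u \<in> kchains V (Suc 0) n" "y = kbd s act n u {1..n}" by auto
    then show "s c y \<in> ?R" using kbd_scale[OF u(1)]
      by (intro image_eqI[OF _ kchains_scale[OF u(1)]]) simp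
  qed
  moreover have "{act m n \<alpha> w | m \<alpha> w. m < n \<and> \<alpha> \<in> FI_hom m n \<and> w \<in> V m} \<subseteq> ?R"
  proof clarify
    fix m \<alpha> w assume m: "m < n" and \<alpha>: "\<alpha> \<in> FI_hom m n" and w: "w \<in> V m"
    have "card (\<alpha> ` {1..m}) < card {1..n}" using m card_image_le[of "{1..m}" \<alpha>] by simp
    then have "\<not> {1..n} \<subseteq> \<alpha> ` {1..m}" using card_mono[of "\<alpha> ` {1..m}" "{1..n}"] by auto
    then obtain x where x: "x \<in> {1..n}" "x \<notin> \<alpha> ` {1..m}" by blast
    obtain \<alpha>' where \<alpha>': "\<alpha>' \<in> FI_hom m (n - 1)" "\<alpha> = FI_comp m (coface (n - 1) x) \<alpha>'"
      using FI_hom_factor_coface[OF \<alpha> x] .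
    have hom: "coface (n - 1) x \<in> FI_hom (n - 1) n"
      using coface_hom[of "{1..n}" x] x pos_interval by simp
    \<comment> \<open>The chain \<open>u\<close> lives on the one set \<open>{1..n} - {x}\<close>;
      the sign in \<open>v\<close> cancels the sign in \<open>kface\<close>.\<close>
    define v where "v = s (ksgn {1..n} x) (act m (n - 1) \<alpha>' w)"
    define u where "u = (\<lambda>S. if S = {1..n} - {x} then v else 0)"
    have v: "v \<in> V (n - 1)" unfolding v_def using act_closed[OF \<alpha>'(1) w] V_scale by blast
    then have u: "u \<in> kchains V (Suc 0) n" using x V_0 unfolding kchains_def u_def by auto
    have "{1..n} - {y} = {1..n} - {x} \<longleftrightarrow> y = x" if "y \<in> {1..n}" for y using that x by blast
    then have "kbd s act n u {1..n} = (\<Sum>y\<in>{1..n}. if y = x then kface s act {1..n} x v else 0)"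
      unfolding kbd_def u_def by (intro trans[OF if_P] sum.cong) (simp_all add: kface_0)
    also have "\<dots> = kface s act {1..n} x v" using x by simp
    also have "\<dots> = act (n - 1) n (coface (n - 1) x) (act m (n - 1) \<alpha>' w)"
      using hom act_closed[OF \<alpha>'(1) w] pos_interval[OF x(1)]
      by (simp add: kface_def v_def act_scale ksgn_square)
    also have "\<dots> = act m n \<alpha> w" using act_comp[OF \<alpha>'(1) hom w] \<alpha>'(2) by simp
    finally show "act m n \<alpha> w \<in> ?R" using u by (metis image_eqI)
  qed
  ultimately show "fi_J s V act n \<subseteq> ?R" unfolding fi_J_def by (intro span_minimal)
  show "?R \<subseteq> fi_J s V act n"
  proof clarify
    fix u assume u: "u \<in> kchains V (Suc 0) n"
    have "kface s act {1..n} x (u ({1..n} - {x})) \<in> fi_J s V act n" if x: "x \<in> {1..n}" for x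
    proof -
      have "coface (n - 1) x \<in> FI_hom (n - 1) n"
        using coface_hom[of "{1..n}" x] x pos_interval by simp
      moreover have "n - 1 < n" using x by auto
      moreover have "u ({1..n} - {x}) \<in> V (n - 1)" using kchains_remove[OF u, of "{1..n}" x] x by simp
      ultimately have "act (n - 1) n (coface (n - 1) x) (u ({1..n} - {x})) \<in> fi_J s V act n"
        unfolding fi_J_def by (intro span_base) blast
      then show ?thesis
        using pos_interval[OF x] unfolding kface_def fi_J_def by (simp add: span_scale)
    qed
    then show "kbd s act n u {1..n} \<in> fi_J s V act n"
      unfolding kbd_def by (auto simp: fi_J_def intro: span_sum)
  qed
qed

end

section \<open>Change of module along a surjection\<close>

locale fi_mor = P: fi_mod t P pact + W: fi_mod s W act
  for t :: "'r::comm_ring_1 \<Rightarrow> 'p::ab_group_add \<Rightarrow> 'p" and P pact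
    and s :: "'r \<Rightarrow> 'w::ab_group_add \<Rightarrow> 'w" and W act +
  fixes f :: "nat \<Rightarrow> 'p \<Rightarrow> 'w"
  assumes morphism: "fi_morphism t P pact s W act f"
    and surj: "\<And>n. f n ` P n = W n"
begin

lemma f_closed: "x \<in> P n \<Longrightarrow> f n x \<in> W n"
  and f_add: "x \<in> P n \<Longrightarrow> y \<in> P n \<Longrightarrow> f n (x + y) = f n x + f n y"
  and f_scale: "x \<in> P n \<Longrightarrow> f n (t r x) = s r (f n x)"
  and f_act: "\<alpha> \<in> FI_hom m n \<Longrightarrow> x \<in> P m \<Longrightarrow> f n (pact m n \<alpha> x) = act m n \<alpha> (f m x)"
  using morphism by (simp_all add: fi_morphism_def)

lemma f_0: "f n 0 = 0"
  using f_scale[OF P.V_0, of n 0] by simp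

lemma f_diff: "x \<in> P n \<Longrightarrow> y \<in> P n \<Longrightarrow> f n (x - y) = f n x - f n y"
  using f_add[of "x - y" n y] P.V_diff by (simp add: eq_diff_eq)

lemma f_sum: "(\<And>i. i \<in> I \<Longrightarrow> g i \<in> P n) \<Longrightarrow> f n (sum g I) = (\<Sum>i\<in>I. f n (g i))"
  by (induction I rule: infinite_finite_induct) (simp_all add: f_0 f_add P.V_sum)

abbreviation Ker :: "nat \<Rightarrow> 'p set" where
  "Ker n \<equiv> {x \<in> P n. f n x = 0}"

lemma fi_mod_Ker: "fi_mod t Ker pact"
proof (rule fi_modI)
  have "P.subspace (Ker n)" for n
    unfolding P.subspace_def using P.V_0 P.V_add P.V_scale by (auto simp: f_0 f_add f_scale)
  moreover have "act m n \<alpha> 0 = 0" if "\<alpha> \<in> FI_hom m n" for m n \<alpha>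
    using W.act_scale[OF that W.V_0, of 0] by simp
  ultimately show "fi_module t Ker pact"
    using P.fi_module unfolding fi_module_def by (auto simp: f_act)
qed

lemma kchains_Ker: "w \<in> kchains Ker a n \<longleftrightarrow> w \<in> kchains P a n \<and> (\<forall>S. f (card S) (w S) = 0)"
proof
  assume w: "w \<in> kchains Ker a n"
  then have "f (card S) (w S) = 0" for S
    using w kchains_outside[OF w, of S] f_0 unfolding kchains_def
    by (cases "S \<subseteq> {1..n} \<and> card S + a = n") (auto dest: spec[of _ S])
  moreover have "w \<in> kchains P a n"
    using w unfolding kchains_def by (smt (verit) mem_Collect_eq)
  ultimately show "w \<in> kchains P a n \<and> (\<forall>S. f (card S) (w S) = 0)" by blast
qed (auto simp: kchains_def)

lemma push_closed:
  "w \<in> kchains P a n \<Longrightarrow> (\<lambda>S. f (card S) (w S)) \<in> kchains W a n"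
  unfolding kchains_def by (auto simp: f_0 f_closed split: if_splits)

lemma push_kbd:
  assumes w: "w \<in> kchains P a n"
  shows "kbd s act n (\<lambda>S. f (card S) (w S)) = (\<lambda>S. f (card S) (kbd t pact n w S))"
proof
  fix S
  show "kbd s act n (\<lambda>S. f (card S) (w S)) S = f (card S) (kbd t pact n w S)"
  proof (cases "S \<subseteq> {1..n}")
    case True
    then have fin: "finite S" using finite_subset by blast
    have face: "kface s act S x (f (card (S - {x})) (w (S - {x}))) = f (card S) (kface t pact S x (w (S - {x})))"
      if "x \<in> S" for x
      using that fin P.coface_hom[OF fin that] P.kchains_remove[OF w True that]
      by (simp add: kface_def f_scale f_act P.act_closed)
    have "kface t pact S x (w (S - {x})) \<in> P (card S)" if "x \<in> S" for x
      using P.kface_closed[OF fin that] P.kchains_remove[OF w True that] by blast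
    then show ?thesis using True by (simp only: kbd_def f_sum face if_True cong: sum.cong)
  qed (simp add: kbd_def f_0)
qed

lemma lift:
  assumes "w \<in> kchains W a n"
  obtains p where "p \<in> kchains P a n" "(\<lambda>S. f (card S) (p S)) = w"
proof
  let ?p = "\<lambda>S. if S \<subseteq> {1..n} \<and> card S + a = n then inv_into (P (card S)) (f (card S)) (w S) else 0"
  have "w S \<in> f (card S) ` P (card S)" if "S \<subseteq> {1..n} \<and> card S + a = n" for S
    using assms that surj unfolding kchains_def by auto
  then show "?p \<in> kchains P a n" "(\<lambda>S. f (card S) (?p S)) = w"
    using assms by (auto simp: kchains_def inv_into_into f_inv_into_f f_0)
qed

text \<open>The long exact sequence in elementary form: the right-hand side says that the connecting
  map from degree \<open>Suc a\<close> of \<open>W\<close> to degree \<open>a\<close> of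
  \<open>Ker\<close> is zero, and exactness of \<open>P\<close> in degree \<open>Suc a\<close> makes
  that map injective.\<close>

lemma kexact_quotient_iff:
  assumes exact: "kexact t P pact (Suc a) n"
  shows "kexact s W act (Suc a) n \<longleftrightarrow>
    (\<forall>p\<in>kchains P (Suc a) n. kbd t pact n p \<in> kchains Ker a n \<longrightarrow>
       (\<exists>z\<in>kchains Ker (Suc a) n. kbd t pact n p = kbd t pact n z))" (is "_ \<longleftrightarrow> ?R")
proof
  assume W: "kexact s W act (Suc a) n"
  show ?R
  proof (intro ballI impI)
    fix p assume p: "p \<in> kchains P (Suc a) n" "kbd t pact n p \<in> kchains Ker a n"
    let ?w = "\<lambda>S. f (card S) (p S)"
    have "kbd s act n ?w = (\<lambda>_. 0)" using push_kbd[OF p(1)] p(2) kchains_Ker by auto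
    then obtain u where u: "u \<in> kchains W (Suc (Suc a)) n" "?w = kbd s act n u"
      using W push_closed[OF p(1)] unfolding kexact_def by blast
    obtain q where q: "q \<in> kchains P (Suc (Suc a)) n" "(\<lambda>S. f (card S) (q S)) = u"
      using lift[OF u(1)] .
    \<comment> \<open>Subtracting the boundary of the lift \<open>q\<close> of \<open>u\<close>
      moves \<open>p\<close> into \<open>Ker\<close> without changing its boundary.\<close>
    let ?z = "\<lambda>S. p S - kbd t pact n q S"
    have bq: "kbd t pact n q \<in> kchains P (Suc a) n" using P.kbd_closed[OF q(1)] .
    have "?z \<in> kchains P (Suc a) n" using P.kchains_diff[OF p(1) bq] .
    moreover have "f (card S) (?z S) = 0" for S
    proof -
      have "f (card S) (kbd t pact n q S) = f (card S) (p S)"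
        using push_kbd[OF q(1)] q(2) u(2) by (metis (no_types))
      moreover have "p S \<in> P (card S)" "kbd t pact n q S \<in> P (card S)"
        using p(1) bq P.V_0 unfolding kchains_def by (auto split: if_splits)
      ultimately show ?thesis by (simp add: f_diff)
    qed
    ultimately have "?z \<in> kchains Ker (Suc a) n" using kchains_Ker by blast
    moreover have "kbd t pact n ?z = kbd t pact n p"
      using P.kbd_diff[OF p(1) bq] P.kbd_kbd[OF q(1)] by simp
    ultimately show "\<exists>z\<in>kchains Ker (Suc a) n. kbd t pact n p = kbd t pact n z"
      by (intro bexI[of _ ?z]) simp_all
  qed
next
  assume R: ?R
  show "kexact s W act (Suc a) n"
    unfolding kexact_def
  proof (intro ballI impI)
    fix w assume w: "w \<in> kchains W (Suc a) n" "kbd s act n w = (\<lambda>_. 0)"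
    obtain p where p: "p \<in> kchains P (Suc a) n" "(\<lambda>S. f (card S) (p S)) = w"
      using lift[OF w(1)] .
    have "f (card S) (kbd t pact n p S) = 0" for S
      using push_kbd[OF p(1)] p(2) w(2) by (metis (no_types))
    then obtain z where z: "z \<in> kchains Ker (Suc a) n" "kbd t pact n p = kbd t pact n z"
      using R p(1) P.kbd_closed[OF p(1)] kchains_Ker by blast
    have zP: "z \<in> kchains P (Suc a) n" using z(1) kchains_Ker by blast
    \<comment> \<open>The corrected lift \<open>p - z\<close> is a cycle of \<open>P\<close>, so it
      bounds some \<open>q\<close>; as \<open>f\<close> kills \<open>z\<close>, the image of
      \<open>q\<close> bounds \<open>w\<close>.\<close>
    have "kbd t pact n (\<lambda>S. p S - z S) = (\<lambda>_. 0)" using P.kbd_diff[OF p(1) zP] z(2) by simp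
    then obtain q where q: "q \<in> kchains P (Suc (Suc a)) n" "(\<lambda>S. p S - z S) = kbd t pact n q"
      using exact P.kchains_diff[OF p(1) zP] unfolding kexact_def by blast
    have "w S = f (card S) (kbd t pact n q S)" for S
    proof -
      have "p S \<in> P (card S)" "z S \<in> P (card S)"
        using p(1) zP P.V_0 unfolding kchains_def by (auto split: if_splits)
      moreover have "f (card S) (z S) = 0" using z(1) kchains_Ker by blast
      ultimately have "f (card S) (p S - z S) = f (card S) (p S)" by (simp add: f_diff)
      then show ?thesis using p(2) q(2) by (metis (no_types))
    qed
    then have "w = kbd s act n (\<lambda>S. f (card S) (q S))" using push_kbd[OF q(1)] by auto
    then show "\<exists>u\<in>kchains W (Suc (Suc a)) n. w = kbd s act n u" using push_closed[OF q(1)] by blast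
  qed
qed

text \<open>Exactness of \<open>P\<close> in the lower degree makes the connecting map surjective
  too, since a cycle of \<open>Ker\<close> bounds in \<open>P\<close>; so it is zero exactly when
  \<open>Ker\<close> has no homology there.\<close>

lemma kexact_shift:
  assumes "kexact t P pact (Suc (Suc a)) n" "kexact t P pact (Suc a) n"
  shows "kexact s W act (Suc (Suc a)) n \<longleftrightarrow> kexact t Ker pact (Suc a) n"
  unfolding kexact_quotient_iff[OF assms(1)]
proof
  assume R: "\<forall>p\<in>kchains P (Suc (Suc a)) n. kbd t pact n p \<in> kchains Ker (Suc a) n \<longrightarrow>
       (\<exists>z\<in>kchains Ker (Suc (Suc a)) n. kbd t pact n p = kbd t pact n z)"
  show "kexact t Ker pact (Suc a) n"
    unfolding kexact_def
  proof (intro ballI impI)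
    fix z assume z: "z \<in> kchains Ker (Suc a) n" "kbd t pact n z = (\<lambda>_. 0)"
    then obtain p where "p \<in> kchains P (Suc (Suc a)) n" "z = kbd t pact n p"
      using assms(2) kchains_Ker unfolding kexact_def by blast
    then show "\<exists>u\<in>kchains Ker (Suc (Suc a)) n. z = kbd t pact n u" using R z(1) by blast
  qed
next
  assume "kexact t Ker pact (Suc a) n"
  then show "\<forall>p\<in>kchains P (Suc (Suc a)) n. kbd t pact n p \<in> kchains Ker (Suc a) n \<longrightarrow>
       (\<exists>z\<in>kchains Ker (Suc (Suc a)) n. kbd t pact n p = kbd t pact n z)"
    using P.kbd_kbd unfolding kexact_def by blast
qed

text \<open>In degree 0 the complex of \<open>P\<close> has homology \<open>P/JP\<close>, so it need
  not be exact. The connecting map now goes to \<open>Ker/JKer\<close>, with image the kernel of the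
  map to \<open>P/JP\<close>, and it is zero exactly when that kernel is.\<close>

lemma kexact_1_iff:
  assumes "kexact t P pact (Suc 0) n"
  shows "kexact s W act (Suc 0) n \<longleftrightarrow> Ker n \<inter> fi_J t P pact n \<subseteq> fi_J t Ker pact n"
proof -
  interpret Ker: fi_mod t Ker pact by (rule fi_mod_Ker)
  have "kbd t pact n p \<in> kchains Ker 0 n \<longleftrightarrow> kbd t pact n p {1..n} \<in> Ker n"
    if "p \<in> kchains P (Suc 0) n" for p
  proof
    assume "kbd t pact n p {1..n} \<in> Ker n"
    moreover have cl: "kbd t pact n p \<in> kchains P 0 n" using P.kbd_closed[OF that] .
    moreover have "f (card S) (kbd t pact n p S) = 0" for S
      using kchains_0_outside[OF cl, of S] \<open>kbd t pact n p {1..n} \<in> Ker n\<close>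
      by (cases "S = {1..n}") (auto simp: f_0)
    ultimately show "kbd t pact n p \<in> kchains Ker 0 n" unfolding kchains_Ker by blast
  qed (use Ker.kchains_closed[of _ 0 n "{1..n}"] in simp)
  moreover have "kbd t pact n p = kbd t pact n z \<longleftrightarrow> kbd t pact n p {1..n} = kbd t pact n z {1..n}"
    if "p \<in> kchains P (Suc 0) n" "z \<in> kchains Ker (Suc 0) n" for p z
    using kchains_0_eqI[OF P.kbd_closed[OF that(1)] Ker.kbd_closed[OF that(2)]] by auto
  ultimately show ?thesis
    unfolding kexact_quotient_iff[OF assms] P.fi_J_eq Ker.fi_J_eq by auto
qed

lemma image_fi_J: "f n ` fi_J t P pact n = fi_J s W act n"
proof -
  have eq: "f n (kbd t pact n p {1..n}) = kbd s act n (\<lambda>S. f (card S) (p S)) {1..n}"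
    if "p \<in> kchains P (Suc 0) n" for p
    using push_kbd[OF that] by simp
  show ?thesis
    unfolding P.fi_J_eq W.fi_J_eq image_image
  proof (intro equalityI subsetI)
    fix y assume "y \<in> (\<lambda>p. f n (kbd t pact n p {1..n})) ` kchains P (Suc 0) n"
    then show "y \<in> (\<lambda>u. kbd s act n u {1..n}) ` kchains W (Suc 0) n"
      using eq push_closed by auto
  next
    fix y assume "y \<in> (\<lambda>u. kbd s act n u {1..n}) ` kchains W (Suc 0) n"
    then obtain u where u: "u \<in> kchains W (Suc 0) n" "y = kbd s act n u {1..n}" by auto
    obtain p where "p \<in> kchains P (Suc 0) n" "(\<lambda>S. f (card S) (p S)) = u" using lift[OF u(1)] .
    then show "y \<in> (\<lambda>p. f n (kbd t pact n p {1..n})) ` kchains P (Suc 0) n"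
      using eq u(2) by auto
  qed
qed

end

section \<open>Exactness on free modules\<close>

text \<open>A basis of \<open>V(S)\<close> for free \<open>V\<close>, indexed by injections into \<open>S\<close> itself instead of \<open>[card S]\<close>: in
  these coordinates the map induced by an inclusion of sets is the identity.\<close>

definition free_ix :: "(nat \<Rightarrow> 'v set) \<Rightarrow> nat set \<Rightarrow> (nat \<times> (nat \<Rightarrow> nat) \<times> 'v) set" where
  "free_ix B S = {(k, \<beta>, b). inj_on \<beta> {1..k} \<and> \<beta> ` {1..k} \<subseteq> S \<and> (\<forall>j. j \<notin> {1..k} \<longrightarrow> \<beta> j = 0) \<and> b \<in> B k}"

definition pos_hom :: "nat set \<Rightarrow> nat \<Rightarrow> (nat \<Rightarrow> nat) \<Rightarrow> nat \<Rightarrow> nat" where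
  "pos_hom S k \<beta> j = (if j \<in> {1..k} then pos S (\<beta> j) else 0)"

definition free_elt :: "(nat \<Rightarrow> nat \<Rightarrow> (nat \<Rightarrow> nat) \<Rightarrow> 'v \<Rightarrow> 'v) \<Rightarrow> nat set \<Rightarrow> nat \<times> (nat \<Rightarrow> nat) \<times> 'v \<Rightarrow> 'v" where
  "free_elt act S = (\<lambda>(k, \<beta>, b). act k (card S) (pos_hom S k \<beta>) b)"

lemma pos_hom_in_FI_hom:
  assumes "finite S" "(k, \<beta>, b) \<in> free_ix B S"
  shows "pos_hom S k \<beta> \<in> FI_hom k (card S)"
proof -
  have \<beta>: "inj_on \<beta> {1..k}" "\<beta> ` {1..k} \<subseteq> S" using assms(2) by (auto simp: free_ix_def)
  have "inj_on (pos S \<circ> \<beta>) {1..k}"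
    using \<beta> inj_on_pos[OF assms(1)] by (intro comp_inj_on) (auto intro: inj_on_subset)
  then have "inj_on (pos_hom S k \<beta>) {1..k}"
    by (rule inj_on_cong[THEN iffD1, rotated]) (simp add: pos_hom_def)
  moreover have "pos S (\<beta> j) \<in> {1..card S}" if "j \<in> {1..k}" for j
    using pos_mem[OF assms(1), of "\<beta> j"] \<beta> that by blast
  ultimately show ?thesis
    unfolding FI_hom_def
    by (intro CollectI conjI image_subsetI) (simp_all add: pos_hom_def)
qed

text \<open>Transport along \<open>pos S\<close> matches these indices with those in
  \<open>fi_free\<close>; the bound \<open>m \<le> card S\<close> is automatic, since
  \<open>{1..m}\<close> injects into \<open>S\<close>.\<close>

lemma bij_betw_free_ix:
  assumes "finite S"
  shows "bij_betw (\<lambda>(k, \<beta>, b). (k, pos_hom S k \<beta>, b)) (free_ix B S)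
    {(m, \<alpha>, b). m \<le> card S \<and> \<alpha> \<in> FI_hom m (card S) \<and> b \<in> B m}" (is "bij_betw ?\<psi> _ ?I")
proof (rule bij_betwI')
  fix x y assume xy: "x \<in> free_ix B S" "y \<in> free_ix B S"
  obtain k \<beta> b l \<gamma> c where eq: "x = (k, \<beta>, b)" "y = (l, \<gamma>, c)" by (metis prod_cases3)
  have "\<beta> = \<gamma>" if h: "pos_hom S k \<beta> = pos_hom S k \<gamma>" "k = l"
  proof
    fix j show "\<beta> j = \<gamma> j"
    proof (cases "j \<in> {1..k}")
      case True
      then have "pos S (\<beta> j) = pos S (\<gamma> j)" using fun_cong[OF h(1), of j] by (simp add: pos_hom_def)
      moreover have "\<beta> j \<in> S" "\<gamma> j \<in> S" using xy eq h(2) True by (auto simp: free_ix_def)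
      ultimately show ?thesis using inj_on_pos[OF assms] by (auto dest: inj_onD)
    next
      case False
      then show ?thesis using xy eq h(2) by (auto simp: free_ix_def)
    qed
  qed
  then show "?\<psi> x = ?\<psi> y \<longleftrightarrow> x = y" using eq by auto
next
  fix x assume x: "x \<in> free_ix B S"
  obtain k \<beta> b where eq: "x = (k, \<beta>, b)" by (metis prod_cases3)
  have "\<beta> ` {1..k} \<subseteq> S" "inj_on \<beta> {1..k}" using x eq by (auto simp: free_ix_def)
  then have "k \<le> card S" using card_inj_on_le[of \<beta> "{1..k}" S] assms by simp
  then show "?\<psi> x \<in> ?I"
    using x eq pos_hom_in_FI_hom[OF assms, of k \<beta> b B] by (simp add: free_ix_def)
next
  fix y assume y: "y \<in> ?I"
  then obtain m \<alpha> b where eq: "y = (m, \<alpha>, b)" and \<alpha>: "\<alpha> \<in> FI_hom m (card S)" and b: "b \<in> B m" by auto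
  define e where "e = inv_into S (pos S)"
  define \<beta> where "\<beta> = (\<lambda>j. if j \<in> {1..m} then e (\<alpha> j) else 0)"
  have \<alpha>j: "\<alpha> j \<in> pos S ` S" if "j \<in> {1..m}" for j
    using \<alpha> that pos_image[OF assms] unfolding FI_hom_def by blast
  have e: "e (\<alpha> j) \<in> S" "pos S (e (\<alpha> j)) = \<alpha> j" if "j \<in> {1..m}" for j
    unfolding e_def using inv_into_into[OF \<alpha>j[OF that]] f_inv_into_f[OF \<alpha>j[OF that]] by auto
  have "inj_on \<beta> {1..m}"
  proof (rule inj_onI)
    fix i j assume ij: "i \<in> {1..m}" "j \<in> {1..m}" "\<beta> i = \<beta> j"
    then have "e (\<alpha> i) = e (\<alpha> j)" unfolding \<beta>_def by (simp only: if_True)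
    then have "\<alpha> i = \<alpha> j" using e(2)[OF ij(1)] e(2)[OF ij(2)] by metis
    then show "i = j" using \<alpha> ij unfolding FI_hom_def by (auto dest: inj_onD)
  qed
  moreover have "\<beta> ` {1..m} \<subseteq> S" using e by (auto simp: \<beta>_def)
  ultimately have "(m, \<beta>, b) \<in> free_ix B S" using b by (auto simp: free_ix_def \<beta>_def)
  moreover have "pos_hom S m \<beta> = \<alpha>"
  proof
    fix j show "pos_hom S m \<beta> j = \<alpha> j"
      using e[of j] \<alpha> by (cases "j \<in> {1..m}") (auto simp: pos_hom_def \<beta>_def FI_hom_def)
  qed
  ultimately show "\<exists>x\<in>free_ix B S. y = ?\<psi> x" using eq by (intro bexI[of _ "(m, \<beta>, b)"]) auto
qed

context fi_mod
begin

lemma free_elt_closed: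
  assumes "finite S" "\<And>k. B k \<subseteq> V k" "i \<in> free_ix B S"
  shows "free_elt act S i \<in> V (card S)"
proof -
  obtain k \<beta> b where eq: "i = (k, \<beta>, b)" by (metis prod_cases3)
  then have "b \<in> V k" using assms by (auto simp: free_ix_def)
  then show ?thesis using eq pos_hom_in_FI_hom[of S k \<beta> b B] assms act_closed by (simp add: free_elt_def)
qed

lemma kface_free_elt:
  assumes S: "finite S" and x: "x \<in> S" and B: "\<And>k. B k \<subseteq> V k" and i: "i \<in> free_ix B (S - {x})"
  shows "kface s act S x (free_elt act (S - {x}) i) = s (ksgn S x) (free_elt act S i)"
proof -
  obtain k \<beta> b where eq: "i = (k, \<beta>, b)" by (metis prod_cases3)
  then have b: "b \<in> V k" using B i by (auto simp: free_ix_def)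
  have hom: "pos_hom (S - {x}) k \<beta> \<in> FI_hom k (card S - 1)"
    using pos_hom_in_FI_hom[of "S - {x}" k \<beta> b B] S x i eq by simp
  have "FI_comp k (coface (card S - 1) (pos S x)) (pos_hom (S - {x}) k \<beta>) = pos_hom S k \<beta>"
  proof
    fix j
    have "\<beta> j \<in> S - {x}" if "j \<in> {1..k}"
      using i eq that unfolding free_ix_def by blast
    then show "FI_comp k (coface (card S - 1) (pos S x)) (pos_hom (S - {x}) k \<beta>) j = pos_hom S k \<beta> j"
      using coface_pos[OF S x, of "\<beta> j"] by (simp add: FI_comp_def pos_hom_def)
  qed
  then show ?thesis
    using act_comp[OF hom coface_hom[OF S x] b] eq S x by (simp add: kface_def free_elt_def)
qed

lemma free_ix_remove: "free_ix B (S - {x}) \<subseteq> free_ix B S"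
  by (auto simp: free_ix_def)

text \<open>The differential fixes every basis index, so it acts on the coefficients of each index
  \<open>i\<close> separately, as the scalar Koszul differential.\<close>

lemma kbd_free_combination:
  assumes B: "\<And>k. B k \<subseteq> V k" and "finite F" and S: "S \<subseteq> {1..n}"
    and ix: "\<And>S i. C S i \<noteq> 0 \<Longrightarrow> i \<in> free_ix B S"
  shows "kbd s act n (\<lambda>S. \<Sum>i\<in>F. s (C S i) (free_elt act S i)) S
    = (\<Sum>i\<in>F. s (\<Sum>x\<in>S. ksgn S x * C (S - {x}) i) (free_elt act S i))"
proof -
  have fin: "finite S" using S finite_subset by blast
  have "kface s act S x (\<Sum>i\<in>F. s (C (S - {x}) i) (free_elt act (S - {x}) i))
      = (\<Sum>i\<in>F. s (ksgn S x * C (S - {x}) i) (free_elt act S i))" if x: "x \<in> S" for x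
  proof -
    \<comment> \<open>Off \<open>free_ix\<close> the element \<open>free_elt\<close> need not lie in
      \<open>V\<close>; there the coefficient is 0 and the term vanishes.\<close>
    have "s (C (S - {x}) i) (free_elt act (S - {x}) i) \<in> V (card S - 1)
        \<and> kface s act S x (s (C (S - {x}) i) (free_elt act (S - {x}) i))
          = s (ksgn S x * C (S - {x}) i) (free_elt act S i)" for i
    proof (cases "C (S - {x}) i = 0")
      case True
      then show ?thesis using V_0 kface_0[OF fin x] by simp
    next
      case False
      note i = ix[OF False]
      have "free_elt act (S - {x}) i \<in> V (card S - 1)"
        using free_elt_closed[OF _ B i] fin x by simp
      then show ?thesis
        using kface_scale[OF fin x] kface_free_elt[OF fin x B i] V_scale by (simp add: mult.commute)
    qed
    then show ?thesis
      using kface_sum[OF fin x, of F "\<lambda>i. s (C (S - {x}) i) (free_elt act (S - {x}) i)"] by simp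
  qed
  then have "kbd s act n (\<lambda>S. \<Sum>i\<in>F. s (C S i) (free_elt act S i)) S
      = (\<Sum>x\<in>S. \<Sum>i\<in>F. s (ksgn S x * C (S - {x}) i) (free_elt act S i))"
    using S by (simp add: kbd_def)
  also have "\<dots> = (\<Sum>i\<in>F. s (\<Sum>x\<in>S. ksgn S x * C (S - {x}) i) (free_elt act S i))"
    by (subst sum.swap) (simp add: scale_sum_left)
  finally show ?thesis .
qed

text \<open>For each basis index \<open>(k, \<beta>, b)\<close> the coefficients of a cycle form a
  scalar Koszul cycle supported on sets containing the image of \<open>\<beta>\<close>. A point
  \<open>x0\<close> outside that image yields a contraction that keeps this support, so the scalar
  primitives assemble into a chain of \<open>V\<close>.\<close>

lemma kexact_free:
  assumes "fi_free s V act" shows "kexact s V act (Suc a) n"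
proof -
  define I where "I B m = {(k, \<alpha>, b). k \<le> m \<and> \<alpha> \<in> FI_hom k m \<and> b \<in> B k}" for B :: "nat \<Rightarrow> 'v set" and m
  define g where "g m i = (case i of (k, \<alpha>, b) \<Rightarrow> act k m \<alpha> b)" for m i
  have "\<exists>B. (\<forall>m. B m \<subseteq> V m) \<and> (\<forall>m. V m = {\<Sum>i\<in>S. s (c i) (g m i) | S c. finite S \<and> S \<subseteq> I B m} \<and>
      (\<forall>S c. finite S \<longrightarrow> S \<subseteq> I B m \<longrightarrow> (\<Sum>i\<in>S. s (c i) (g m i)) = 0 \<longrightarrow> (\<forall>i\<in>S. c i = 0)))"
    using assms unfolding fi_free_def Let_def I_def g_def .
  then obtain B where "\<forall>k. B k \<subseteq> V k"
    and free: "\<forall>m. V m = {\<Sum>i\<in>S. s (c i) (g m i) | S c. finite S \<and> S \<subseteq> I B m} \<and>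
      (\<forall>S c. finite S \<longrightarrow> S \<subseteq> I B m \<longrightarrow> (\<Sum>i\<in>S. s (c i) (g m i)) = 0 \<longrightarrow> (\<forall>i\<in>S. c i = 0))"
    by (elim exE conjE)
  then have B: "B k \<subseteq> V k" for k by blast
  note gen = free[THEN spec, THEN conjunct1]
    and ind = free[THEN spec, THEN conjunct2, rule_format]
  define \<psi> where "\<psi> S = (\<lambda>(k, \<beta> :: nat \<Rightarrow> nat, b :: 'v). (k, pos_hom S k \<beta>, b))" for S
  have elt: "free_elt act S i = g (card S) (\<psi> S i)" for S i
    by (simp add: free_elt_def g_def \<psi>_def split: prod.split)
  have bij: "bij_betw (\<psi> S) (free_ix B S) (I B (card S))" if "finite S" for S
    using bij_betw_free_ix[OF that, of B] unfolding \<psi>_def I_def .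
  have ind': "c i = 0"
    if fin: "finite S" "finite F" and z: "(\<Sum>i\<in>F. s (c i) (free_elt act S i)) = 0"
      and c: "\<And>i. c i \<noteq> 0 \<Longrightarrow> i \<in> free_ix B S" and i: "i \<in> F" for S F c i
  proof (cases "i \<in> free_ix B S")
    case True
    let ?F = "F \<inter> free_ix B S"
    have inj: "inj_on (\<psi> S) ?F" and sub: "\<psi> S ` ?F \<subseteq> I B (card S)"
      using bij[OF fin(1)] unfolding bij_betw_def by (auto intro: inj_on_subset)
    have "(\<Sum>j\<in>\<psi> S ` ?F. s (c (inv_into ?F (\<psi> S) j)) (g (card S) j))
        = (\<Sum>i\<in>?F. s (c i) (free_elt act S i))"
      using inj by (simp add: sum.reindex elt)
    also have "\<dots> = (\<Sum>i\<in>F. s (c i) (free_elt act S i))"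
    proof (rule sum.mono_neutral_left)
      have "c i = 0" if "i \<notin> free_ix B S" for i using c that by blast
      then show "\<forall>i\<in>F - ?F. s (c i) (free_elt act S i) = 0" by simp
    qed (use fin in auto)
    finally have "c (inv_into ?F (\<psi> S) (\<psi> S i)) = 0"
      using ind[OF _ sub, of "\<lambda>j. c (inv_into ?F (\<psi> S) j)" "\<psi> S i"] z fin True i by simp
    then show ?thesis using inj True i by simp
  qed (use c in blast)
  have rep: "\<exists>c. finite {i. c i \<noteq> 0} \<and> {i. c i \<noteq> 0} \<subseteq> free_ix B S
      \<and> v = (\<Sum>i\<in>{i. c i \<noteq> 0}. s (c i) (free_elt act S i))"
    if fin: "finite S" and v: "v \<in> V (card S)" for S v
  proof -
    obtain F c where F: "finite F" "F \<subseteq> I B (card S)" "v = (\<Sum>i\<in>F. s (c i) (g (card S) i))"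
      using v gen[of "card S"] by auto
    let ?F = "{i \<in> free_ix B S. \<psi> S i \<in> F}"
    have bijF: "bij_betw (\<psi> S) ?F F"
    proof (rule bij_betw_subset[OF bij[OF fin]])
      have img: "\<psi> S ` free_ix B S = I B (card S)" using bij[OF fin] by (simp add: bij_betw_def)
      show "\<psi> S ` ?F = F"
      proof (intro equalityI subsetI)
        fix j assume "j \<in> F"
        then have "j \<in> \<psi> S ` free_ix B S" using F(2) img by blast
        then show "j \<in> \<psi> S ` ?F" using \<open>j \<in> F\<close> by blast
      qed blast
    qed blast
    then have finF: "finite ?F" using F(1) bij_betw_finite by blast
    define c' where "c' = (\<lambda>i. if i \<in> ?F then c (\<psi> S i) else 0)"
    have sub: "{i. c' i \<noteq> 0} \<subseteq> ?F" by (auto simp: c'_def)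
    have "v = (\<Sum>i\<in>?F. s (c (\<psi> S i)) (g (card S) (\<psi> S i)))"
      using F(3) sum.reindex_bij_betw[OF bijF, of "\<lambda>i. s (c i) (g (card S) i)"] by simp
    also have "\<dots> = (\<Sum>i\<in>?F. s (c' i) (free_elt act S i))" by (simp add: c'_def elt)
    also have "\<dots> = (\<Sum>i\<in>{i. c' i \<noteq> 0}. s (c' i) (free_elt act S i))"
      using finF sub by (intro sum.mono_neutral_right) auto
    finally show ?thesis using sub finite_subset[OF sub finF] by blast
  qed
  show ?thesis
    unfolding kexact_def
  proof (intro ballI impI)
    fix w assume w: "w \<in> kchains V (Suc a) n" and cyc: "kbd s act n w = (\<lambda>_. 0)"
    have "\<exists>c. if S \<subseteq> {1..n} then finite {i. c i \<noteq> 0} \<and> {i. c i \<noteq> 0} \<subseteq> free_ix B S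
        \<and> w S = (\<Sum>i\<in>{i. c i \<noteq> 0}. s (c i) (free_elt act S i)) else c = (\<lambda>_. 0)" for S
    proof (cases "S \<subseteq> {1..n}")
      case True
      then have "finite S" using finite_subset by blast
      then show ?thesis
        unfolding if_P[OF True] by (rule rep[OF _ kchains_closed[OF w True]])
    qed simp
    then have "\<exists>C. \<forall>S. if S \<subseteq> {1..n} then finite {i. C S i \<noteq> 0} \<and> {i. C S i \<noteq> 0} \<subseteq> free_ix B S
        \<and> w S = (\<Sum>i\<in>{i. C S i \<noteq> 0}. s (C S i) (free_elt act S i)) else C S = (\<lambda>_. 0)"
      by (intro choice allI)
    then obtain C where "\<forall>S. if S \<subseteq> {1..n} then finite {i. C S i \<noteq> 0} \<and> {i. C S i \<noteq> 0} \<subseteq> free_ix B S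
        \<and> w S = (\<Sum>i\<in>{i. C S i \<noteq> 0}. s (C S i) (free_elt act S i)) else C S = (\<lambda>_. 0)" ..
    note C = this[THEN spec]
    have Csub: "S \<subseteq> {1..n}" if "C S i \<noteq> 0" for S i using C[of S] that by (auto split: if_splits)
    have Cix: "i \<in> free_ix B S" if "C S i \<noteq> 0" for S i using C[of S] that by (auto split: if_splits)
    \<comment> \<open>Finite because \<open>{1..n}\<close> has finitely many subsets; a common index
      set lets the sums over indices and over faces be exchanged.\<close>
    define F where "F = (\<Union>S\<in>Pow {1..n}. {i. C S i \<noteq> 0})"
    have F: "finite F" unfolding F_def using C by (auto intro!: finite_UN_I)
    have CF: "i \<in> F" if "C S i \<noteq> 0" for S i using that Csub[OF that] unfolding F_def by auto
    have wF: "w S = (\<Sum>i\<in>F. s (C S i) (free_elt act S i))" for S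
    proof (cases "S \<subseteq> {1..n}")
      case True
      then have "w S = (\<Sum>i\<in>{i. C S i \<noteq> 0}. s (C S i) (free_elt act S i))" using C[of S] by simp
      also have "\<dots> = (\<Sum>i\<in>F. s (C S i) (free_elt act S i))"
        using F CF by (intro sum.mono_neutral_left) auto
      finally show ?thesis .
    next
      case False
      then show ?thesis using C[of S] kchains_outside[OF w, of S] by simp
    qed
    have Ccard: "card S + Suc a = n" if "C S i \<noteq> 0" for S i
    proof (rule ccontr)
      assume "card S + Suc a \<noteq> n"
      then have "w S = 0" using kchains_outside[OF w] by blast
      then have "C S i = 0"
        using wF[of S] Cix CF[OF that] F Csub[OF that] finite_subset[of S "{1..n}"]
        by (intro ind'[of S F]) auto
      then show False using that by simp
    qed
    have Ccyc: "(\<Sum>x\<in>S. ksgn S x * C (S - {x}) i) = 0" if S: "S \<subseteq> {1..n}" for S i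
    proof (cases "i \<in> F")
      case True
      show ?thesis
      proof (rule ind'[of S F _ i])
        have "w = (\<lambda>S. \<Sum>i\<in>F. s (C S i) (free_elt act S i))" using wF by auto
        then have "kbd s act n (\<lambda>S. \<Sum>i\<in>F. s (C S i) (free_elt act S i)) S = 0"
          using fun_cong[OF cyc, of S] by (simp only:)
        moreover have "kbd s act n (\<lambda>S. \<Sum>i\<in>F. s (C S i) (free_elt act S i)) S
            = (\<Sum>i\<in>F. s (\<Sum>x\<in>S. ksgn S x * C (S - {x}) i) (free_elt act S i))"
          by (rule kbd_free_combination[where B = B, OF B F S]) (rule Cix)
        ultimately show "(\<Sum>i\<in>F. s (\<Sum>x\<in>S. ksgn S x * C (S - {x}) i) (free_elt act S i)) = 0"
          by (simp only:)
        show "i \<in> free_ix B S" if nz: "(\<Sum>x\<in>S. ksgn S x * C (S - {x}) i) \<noteq> 0" for i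
        proof -
          obtain x where "ksgn S x * C (S - {x}) i \<noteq> 0"
            using nz by (rule sum.not_neutral_contains_not_neutral)
          then have "C (S - {x}) i \<noteq> 0" by auto
          then show ?thesis using Cix free_ix_remove by blast
        qed
        show "finite S" using S finite_subset by blast
      qed (use F True in auto)
    next
      case False
      then have "C (S - {x}) i = 0" for x using CF by blast
      then show ?thesis by simp
    qed
    \<comment> \<open>The point depends on the index but not on \<open>S\<close>, as a single
      homotopy requires. It exists because in positive degree every \<open>S\<close> with
      \<open>C S i \<noteq> 0\<close> misses a point of \<open>{1..n}\<close>.\<close>
    define x0 where "x0 = (\<lambda>(k, \<beta> :: nat \<Rightarrow> nat, b :: 'v). SOME x. x \<in> {1..n} - \<beta> ` {1..k})"
    have x0: "x0 (k, \<beta>, b) \<in> {1..n} - \<beta> ` {1..k}" if iF: "(k, \<beta>, b) \<in> F" for k \<beta> b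
    proof -
      obtain S where S: "C S (k, \<beta>, b) \<noteq> 0" using iF unfolding F_def by auto
      have "card S < n" using Ccard[OF S] by simp
      then have "S \<noteq> {1..n}" by auto
      moreover have "\<beta> ` {1..k} \<subseteq> S" using Cix[OF S] by (auto simp: free_ix_def)
      ultimately have "{1..n} - \<beta> ` {1..k} \<noteq> {}" using Csub[OF S] by blast
      then show ?thesis unfolding x0_def prod.case by (rule some_in_eq[THEN iffD2])
    qed
    define G where "G = (\<lambda>S i. if i \<in> F then if x0 i \<in> S then 0
        else ksgn (insert (x0 i) S) (x0 i) * C (insert (x0 i) S) i else 0)"
    \<comment> \<open>As \<open>x0 i\<close> is not a value of \<open>\<beta>\<close>, deleting it
      from \<open>insert (x0 i) S\<close> leaves the image of \<open>\<beta>\<close> inside; the set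
      loses one element, so the degree rises by one.\<close>
    have G: "i \<in> free_ix B S \<and> S \<subseteq> {1..n} \<and> card S + Suc (Suc a) = n" if nz: "G S i \<noteq> 0" for S i
    proof -
      obtain k \<beta> b where eq: "i = (k, \<beta>, b)" by (metis prod_cases3)
      have iF: "i \<in> F" and nin: "x0 i \<notin> S" and Cnz: "C (insert (x0 i) S) i \<noteq> 0"
        using nz unfolding G_def by (auto split: if_splits)
      have x0i: "x0 i \<notin> \<beta> ` {1..k}" using x0[of k \<beta> b] iF eq by simp
      have "\<beta> ` {1..k} \<subseteq> insert (x0 i) S" using Cix[OF Cnz] unfolding eq free_ix_def by simp
      then have "\<beta> ` {1..k} \<subseteq> S" unfolding subset_insert[OF x0i] .
      then have "i \<in> free_ix B S" using Cix[OF Cnz] unfolding eq free_ix_def by simp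
      moreover have "finite S" using finite_subset[OF Csub[OF Cnz]] by simp
      ultimately show ?thesis using Ccard[OF Cnz] Csub[OF Cnz] nin by auto
    qed
    have CG: "C S i = (\<Sum>x\<in>S. ksgn S x * G (S - {x}) i)" if S: "S \<subseteq> {1..n}" and iF: "i \<in> F" for S i
    proof -
      obtain k \<beta> b where "i = (k, \<beta>, b)" by (metis prod_cases3)
      then have "x0 i \<in> {1..n}" using x0[of k \<beta> b] iF by simp
      then show ?thesis
        using scalar_koszul_exact[of "x0 i" n "\<lambda>S. C S i" S] Ccyc S iF by (simp add: G_def)
    qed
    define u where "u = (\<lambda>S. \<Sum>i\<in>F. s (G S i) (free_elt act S i))"
    have "u \<in> kchains V (Suc (Suc a)) n"
      unfolding kchains_def
    proof (intro CollectI allI)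
      fix S
      have "s (G S i) (free_elt act S i) \<in> V (card S)" for i
      proof (cases "G S i = 0")
        case False
        then have "finite S" "i \<in> free_ix B S" using G finite_subset[of S "{1..n}"] by auto
        then show ?thesis using V_scale free_elt_closed[OF _ B] by blast
      qed (simp add: V_0)
      then have "u S \<in> V (card S)" unfolding u_def by (intro V_sum)
      moreover have "u S = 0" if "\<not> (S \<subseteq> {1..n} \<and> card S + Suc (Suc a) = n)"
      proof -
        have "G S i = 0" for i using G[of S i] that by blast
        then show ?thesis by (simp add: u_def)
      qed
      ultimately show "if S \<subseteq> {1..n} \<and> card S + Suc (Suc a) = n then u S \<in> V (card S) else u S = 0"
        by presburger
    qed
    moreover have "w = kbd s act n u"
    proof
      fix S show "w S = kbd s act n u S"
      proof (cases "S \<subseteq> {1..n}")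
        case True
        have "kbd s act n u S = (\<Sum>i\<in>F. s (\<Sum>x\<in>S. ksgn S x * G (S - {x}) i) (free_elt act S i))"
          unfolding u_def by (rule kbd_free_combination[where B = B, OF B F True]) (use G in blast)
        also have "\<dots> = w S" using CG[OF True] wF by simp
        finally show ?thesis by simp
      next
        case False
        then show ?thesis using kchains_outside[OF w, of S] by (simp add: kbd_def)
      qed
    qed
    ultimately show "\<exists>u\<in>kchains V (Suc (Suc a)) n. w = kbd s act n u" by blast
  qed
qed

end

section \<open>Modules of finite degree\<close>

text \<open>Pairing \<open>X\<close> with \<open>insert i X\<close> keeps the value of
  \<open>q\<close> and flips the sign.\<close>

lemma sum_Pow_alternating:
  fixes q :: "'i set \<Rightarrow> 'v::ab_group_add" and s :: "'r::comm_ring_1 \<Rightarrow> 'v \<Rightarrow> 'v"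
  assumes "module s" "finite A" "i \<in> A"
    and q: "\<And>X. X \<subseteq> A - {i} \<Longrightarrow> q (insert i X) = q X"
  shows "(\<Sum>X\<in>Pow A. s ((-1) ^ card X) (q X)) = 0"
proof -
  interpret module s by fact
  have A: "A = insert i (A - {i})" using assms(3) by blast
  have inj: "inj_on (insert i) (Pow (A - {i}))" by (auto simp: inj_on_def)
  have "(\<Sum>X\<in>Pow A. s ((-1) ^ card X) (q X)) = (\<Sum>X\<in>Pow (A - {i}). s ((-1) ^ card X) (q X))
      + (\<Sum>X\<in>insert i ` Pow (A - {i}). s ((-1) ^ card X) (q X))"
    by (subst A, subst Pow_insert, rule sum.union_disjoint) (use assms(2) in auto)
  also have "(\<Sum>X\<in>insert i ` Pow (A - {i}). s ((-1) ^ card X) (q X))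
      = (\<Sum>X\<in>Pow (A - {i}). s ((-1) ^ card (insert i X)) (q (insert i X)))"
    using inj by (simp add: sum.reindex)
  also have "\<dots> = (\<Sum>X\<in>Pow (A - {i}). - s ((-1) ^ card X) (q X))"
  proof (rule sum.cong)
    fix X assume "X \<in> Pow (A - {i})"
    then have "X \<subseteq> A - {i}" "finite X" "i \<notin> X" using assms(2) finite_subset by auto
    then show "s ((-1) ^ card (insert i X)) (q (insert i X)) = - s ((-1) ^ card X) (q X)"
      by (simp add: q)
  qed simp
  finally show ?thesis by (simp add: sum_negf)
qed

text \<open>\<open>tpick X\<close> picks one element from each of the pairs \<open>{2i - 1, 2i}\<close>.\<close>

definition tpick :: "nat set \<Rightarrow> nat \<Rightarrow> nat" where
  "tpick X i = (if i \<in> X then 2 * i else 2 * i - 1)"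

lemma tpick_less: "1 \<le> i \<Longrightarrow> i < j \<Longrightarrow> tpick X i < tpick X j"
  by (auto simp: tpick_def)

lemma tpick_inj_on: "inj_on (tpick X) {1..m}"
proof (rule linorder_inj_onI)
  fix i j assume "i < j" "i \<in> {1..m}"
  then show "tpick X i \<noteq> tpick X j" using tpick_less[of i j X] by simp
qed auto

text \<open>The picks increase with \<open>i\<close> whatever \<open>X\<close> is, so the signs and
  cofaces at a transversal depend on \<open>i\<close> and \<open>m\<close> only.\<close>

lemma pos_tpick:
  assumes "i \<in> {1..m}" shows "pos (tpick X ` {1..m}) (tpick X i) = i"
proof -
  have "tpick X j \<le> tpick X i \<longleftrightarrow> j \<le> i" if "j \<in> {1..m}" for j
    using tpick_less[of i j X] tpick_less[of j i X] assms that
    by (cases i j rule: linorder_cases) auto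
  then have "{y \<in> tpick X ` {1..m}. y \<le> tpick X i} = tpick X ` {j \<in> {1..m}. j \<le> i}" by blast
  also have "{j \<in> {1..m}. j \<le> i} = {1..i}" using assms by auto
  finally have "{y \<in> tpick X ` {1..m}. y \<le> tpick X i} = tpick X ` {1..i}" .
  moreover have "inj_on (tpick X) {1..i}" by (rule tpick_inj_on)
  ultimately show ?thesis by (simp add: pos_def card_image)
qed

text \<open>The transversal for \<open>{}\<close> is all odd, whereas \<open>i \<in> X\<close>
  contributes the even number \<open>2 * i\<close>.\<close>

lemma tpick_image_eq_empty:
  assumes "X \<subseteq> {1..m}" "tpick X ` {1..m} = tpick {} ` {1..m}" shows "X = {}"
proof (rule ccontr)
  assume "X \<noteq> {}"
  then obtain i where i: "i \<in> X" "i \<in> {1..m}" using assms(1) by blast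
  then have "tpick X i \<in> tpick {} ` {1..m}" using assms(2) by blast
  then obtain j where "j \<in> {1..m}" "tpick X i = tpick {} j" by blast
  then show False using i(1) by (simp add: tpick_def) presburger
qed

context fi_mod
begin

text \<open>The sum over all transversals of the pairs \<open>{2i - 1, 2i}\<close>, with sign the parity of the number of
  even elements, kills boundaries, because exchanging the two elements of a pair changes the sign
  but no position. It maps the cycle with value \<open>v\<close> at a single transversal to \<open>\<plusminus>v\<close>.\<close>

lemma not_kexact_top:
  assumes v: "v \<in> V m" "v \<noteq> 0" and top: "V (Suc m) = {0}"
  shows "\<not> kexact s V act (Suc m) (2 * m + 1)"
proof
  let ?n = "2 * m + 1" and ?T = "\<lambda>X. tpick X ` {1..m}"
  assume exact: "kexact s V act (Suc m) ?n"
  have card_T: "card (?T X) = m" for X using tpick_inj_on[of X m] by (simp add: card_image)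
  have T_sub: "?T X \<subseteq> {1..?n}" for X by (auto simp: tpick_def)
  \<comment> \<open>The complement of a transversal in \<open>{1..2 * m + 1}\<close> has
    \<open>m + 1\<close> elements, which is the degree \<open>Suc m\<close>; the last point lies in
    no pair.\<close>
  define w where "w = (\<lambda>S. if S = ?T {} then v else 0)"
  have w: "w \<in> kchains V (Suc m) ?n"
    unfolding kchains_def w_def using card_T T_sub[of "{}"] v(1) V_0 by auto
  \<comment> \<open>Chains of degree \<open>m\<close> have their components in
    \<open>V (Suc m)\<close>, which is zero.\<close>
  have "kbd s act ?n w = (\<lambda>_. 0)"
  proof
    fix S
    show "kbd s act ?n w S = 0"
    proof (cases "S \<subseteq> {1..?n} \<and> card S + m = ?n")
      case True
      then have "card S = Suc m" by simp
      then show ?thesis using kchains_closed[OF kbd_closed[OF w], of S] True top by simp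
    next
      case False
      then show ?thesis by (rule kchains_outside[OF kbd_closed[OF w]])
    qed
  qed
  then obtain u where u: "u \<in> kchains V (Suc (Suc m)) ?n" "w = kbd s act ?n u"
    using exact w unfolding kexact_def by blast
  \<comment> \<open>The face term of a transversal at its \<open>i\<close>-th pick. The position of
    that pick is \<open>i\<close>, so \<open>X\<close> enters only through the picks from the other
    pairs.\<close>
  define q where "q = (\<lambda>i X. s ((-1) ^ i) (act (m - 1) m (coface (m - 1) i) (u (tpick X ` ({1..m} - {i})))))"
  have wT: "w (?T X) = (\<Sum>i\<in>{1..m}. q i X)" for X
  proof -
    have "w (?T X) = (\<Sum>x\<in>?T X. kface s act (?T X) x (u (?T X - {x})))"
      using u(2) T_sub[of X] by (simp add: kbd_def)
    also have "\<dots> = (\<Sum>i\<in>{1..m}. kface s act (?T X) (tpick X i) (u (?T X - {tpick X i})))"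
      using sum.reindex[OF tpick_inj_on] by (simp add: comp_def)
    also have "\<dots> = (\<Sum>i\<in>{1..m}. q i X)"
    proof (rule sum.cong)
      fix i assume i: "i \<in> {1..m}"
      have "?T X - {tpick X i} = tpick X ` ({1..m} - {i})"
        using inj_on_image_set_diff[OF tpick_inj_on[of X m], of "{1..m}" "{i}"] i by simp
      then show "kface s act (?T X) (tpick X i) (u (?T X - {tpick X i})) = q i X"
        by (simp only: kface_def q_def ksgn_def card_T pos_tpick[OF i])
    qed simp
    finally show ?thesis .
  qed
  \<comment> \<open>Among these transversals \<open>w\<close> is nonzero only at the one for
    \<open>X = {}\<close>, where the sign is 1.\<close>
  have "v = (\<Sum>X\<in>Pow {1..m}. if X = {} then v else 0)" by simp
  also have "\<dots> = (\<Sum>X\<in>Pow {1..m}. s ((-1) ^ card X) (w (?T X)))"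
  proof (rule sum.cong)
    fix X assume "X \<in> Pow {1..m}"
    then show "(if X = {} then v else 0) = s ((-1) ^ card X) (w (?T X))"
      using tpick_image_eq_empty[of X m] by (auto simp: w_def)
  qed simp
  also have "\<dots> = (\<Sum>X\<in>Pow {1..m}. \<Sum>i\<in>{1..m}. s ((-1) ^ card X) (q i X))"
    by (simp only: wT scale_sum_right)
  also have "\<dots> = (\<Sum>i\<in>{1..m}. \<Sum>X\<in>Pow {1..m}. s ((-1) ^ card X) (q i X))"
    by (rule sum.swap)
  also have "\<dots> = 0"
  proof (rule sum.neutral, rule ballI, rule sum_Pow_alternating[OF module_axioms])
    fix i X
    have "tpick (insert i X) ` ({1..m} - {i}) = tpick X ` ({1..m} - {i})"
      by (rule image_cong) (auto simp: tpick_def)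
    then show "q i (insert i X) = q i X" by (simp add: q_def)
  qed auto
  finally show False using v(2) by simp
qed

text \<open>Chains of degree \<open>a\<close> take values in \<open>V (n - a)\<close>, so only the
  zero chain is left. The guard \<open>a \<le> n\<close> is there because subtraction truncates; for
  \<open>a > n\<close> no set has the required size.\<close>

lemma kexact_trivial:
  assumes "a \<le> n \<Longrightarrow> V (n - a) = {0}"
  shows "kexact s V act a n"
  unfolding kexact_def
proof (intro ballI impI)
  fix w assume w: "w \<in> kchains V a n"
  have "w S = 0" for S
  proof (cases "S \<subseteq> {1..n} \<and> card S + a = n")
    case True
    then have "a \<le> n" "n - a = card S" by auto
    then show ?thesis using kchains_closed[OF w, of S] assms True by simp
  qed (rule kchains_outside[OF w])
  then have "w = kbd s act n (\<lambda>_. 0)"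
    using kbd_scale[OF kchains_zero, where r = 0 and n = n] by auto
  then show "\<exists>u\<in>kchains V (Suc a) n. w = kbd s act n u" using kchains_zero by blast
qed

end

section \<open>Comparison with a free resolution\<close>

locale fi_resolution =
  fixes s :: "'r::comm_ring_1 \<Rightarrow> 'v::ab_group_add \<Rightarrow> 'v"
    and V act
    and t :: "'r \<Rightarrow> 'p::ab_group_add \<Rightarrow> 'p"
    and P pact d eps
  assumes fi_module: "fi_module s V act"
    and resolution: "fi_free_resolution s V act t P pact d eps"
begin

lemmas resolution_unfolded = resolution[unfolded fi_free_resolution_def]

lemma fi_module_P: "fi_module t (P k) (pact k)"
  and fi_free_P: "fi_free t (P k) (pact k)"
  using resolution_unfolded[THEN conjunct1] by simp_all

lemmas morphism_d = resolution_unfolded[THEN conjunct2, THEN conjunct1, rule_format]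
  and morphism_eps = resolution_unfolded[THEN conjunct2, THEN conjunct2, THEN conjunct1]

lemmas surj_eps = resolution_unfolded[THEN conjunct2, THEN conjunct2, THEN conjunct2, THEN conjunct1, rule_format]
  and ker_eps = resolution_unfolded[THEN conjunct2, THEN conjunct2, THEN conjunct2, THEN conjunct2, THEN conjunct1, rule_format]
  and ker_d = resolution_unfolded[THEN conjunct2, THEN conjunct2, THEN conjunct2, THEN conjunct2, THEN conjunct2, rule_format]

text \<open>The index is that of the ambient \<open>P k\<close>, so \<open>syzygy 0\<close> is the
  kernel of \<open>eps\<close>, the first syzygy of \<open>V\<close>.\<close>

definition syzygy :: "nat \<Rightarrow> nat \<Rightarrow> 'p set" where
  "syzygy k n = d (Suc k) n ` P (Suc k) n"

lemma syzygy_0: "syzygy 0 n = {x \<in> P 0 n. eps n x = 0}"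
  and syzygy_Suc: "syzygy (Suc k) n = {x \<in> P (Suc k) n. d (Suc k) n x = 0}"
  unfolding syzygy_def ker_eps ker_d by simp_all

lemma kexact_P: "kexact t (P k) (pact k) (Suc a) n"
  by (rule fi_mod.kexact_free[OF fi_modI[OF fi_module_P] fi_free_P])

lemma fi_mor_eps: "fi_mor t (P 0) (pact 0) s V act eps"
  by (intro fi_mor.intro fi_modI fi_mor_axioms.intro fi_module_P fi_module morphism_eps surj_eps)

lemma fi_mod_syzygy_0: "fi_mod t (syzygy 0) (pact 0)"
  using fi_mor.fi_mod_Ker[OF fi_mor_eps] by (simp add: syzygy_0[abs_def])

text \<open>The assumption on \<open>syzygy k\<close> is discharged by induction in
  \<open>fi_mod_syzygy\<close>: each syzygy is the kernel of the surjection onto the previous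
  one.\<close>

lemma fi_mor_d_if:
  assumes "fi_mod t (syzygy k) (pact k)"
  shows "fi_mor t (P (Suc k)) (pact (Suc k)) t (syzygy k) (pact k) (d (Suc k))"
proof (intro fi_mor.intro fi_mor_axioms.intro)
  show "fi_mod t (P (Suc k)) (pact (Suc k))"
    by (rule fi_modI[OF fi_module_P])
  show "fi_morphism t (P (Suc k)) (pact (Suc k)) t (syzygy k) (pact k) (d (Suc k))"
    using morphism_d[of k] unfolding fi_morphism_def syzygy_def by blast
qed (use assms in \<open>auto simp: syzygy_def\<close>)

lemma fi_mod_syzygy: "fi_mod t (syzygy k) (pact k)"
proof (induction k)
  case (Suc k)
  then show ?case
    using fi_mor.fi_mod_Ker[OF fi_mor_d_if[OF Suc]] by (simp add: syzygy_Suc[abs_def])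
qed (rule fi_mod_syzygy_0)

lemmas fi_mor_d = fi_mor_d_if[OF fi_mod_syzygy]

text \<open>Modulo its kernel, the image of \<open>d (Suc (Suc k))\<close>, the map
  \<open>d (Suc k)\<close> identifies \<open>P (Suc k)\<close> with \<open>syzygy k\<close> and
  takes \<open>J(P (Suc k))\<close> onto \<open>J(syzygy k)\<close>. So the homology is the
  intersection of \<open>syzygy k\<close> with \<open>J(P k)\<close>, modulo
  \<open>J(syzygy k)\<close>.\<close>

lemma homology_zero_iff:
  "\<not> fi_homology_nonzero t P pact d k n \<longleftrightarrow>
     syzygy k n \<inter> fi_J t (P k) (pact k) n \<subseteq> fi_J t (syzygy k) (pact k) n" (is "?L \<longleftrightarrow> ?R")
proof -
  interpret d: fi_mor t "P (Suc k)" "pact (Suc k)" t "syzygy k" "pact k" "d (Suc k)"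
    by (rule fi_mor_d)
  let ?J = "fi_J t (P (Suc k)) (pact (Suc k)) n"
  have J: "?J \<subseteq> P (Suc k) n"
    unfolding d.P.fi_J_eq using d.P.kchains_closed[OF d.P.kbd_closed, of _ 0 n "{1..n}"] by auto
  have ker: "d (Suc (Suc k)) n ` P (Suc (Suc k)) n = {x \<in> P (Suc k) n. d (Suc k) n x = 0}"
    using syzygy_Suc[of k n] by (simp add: syzygy_def)
  have "x \<in> {y + z | y z. y \<in> d (Suc (Suc k)) n ` P (Suc (Suc k)) n \<and> z \<in> ?J}
      \<longleftrightarrow> d (Suc k) n x \<in> d (Suc k) n ` ?J" if x: "x \<in> P (Suc k) n" for x
  proof
    assume "x \<in> {y + z | y z. y \<in> d (Suc (Suc k)) n ` P (Suc (Suc k)) n \<and> z \<in> ?J}"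
    then obtain y z where yz: "x = y + z" "y \<in> P (Suc k) n" "d (Suc k) n y = 0" "z \<in> ?J"
      unfolding ker by auto
    then have "d (Suc k) n x = d (Suc k) n z" using d.f_add J by auto
    then show "d (Suc k) n x \<in> d (Suc k) n ` ?J" using yz(4) by blast
  next
    assume "d (Suc k) n x \<in> d (Suc k) n ` ?J"
    then obtain z where z: "z \<in> ?J" "d (Suc k) n x = d (Suc k) n z" by blast
    then have "d (Suc k) n (x - z) = 0" "x - z \<in> P (Suc k) n"
      using d.f_diff[OF x] d.P.V_diff[OF x] J by auto
    moreover have "x = (x - z) + z" by simp
    ultimately show "x \<in> {y + z | y z. y \<in> d (Suc (Suc k)) n ` P (Suc (Suc k)) n \<and> z \<in> ?J}"
      unfolding ker using z(1) by blast
  qed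
  then show ?thesis
    unfolding fi_homology_nonzero_def d.image_fi_J by (auto simp: syzygy_def)
qed

text \<open>Index \<open>j\<close> of \<open>fi_homology_nonzero\<close> means homological degree
  \<open>j + 1\<close>, so degree \<open>i + 1\<close> of \<open>syzygy k\<close> corresponds to
  degree \<open>k + i + 2\<close> of \<open>V\<close>. Each shift trades one degree for the next
  syzygy, down to degree 1, where \<open>homology_zero_iff\<close> applies.\<close>

lemma kexact_syzygy_iff:
  "kexact t (syzygy k) (pact k) (Suc i) n \<longleftrightarrow> \<not> fi_homology_nonzero t P pact d (k + Suc i) n"
proof (induction i arbitrary: k)
  case 0
  interpret d: fi_mor t "P (Suc k)" "pact (Suc k)" t "syzygy k" "pact k" "d (Suc k)"
    by (rule fi_mor_d)
  show ?case
    using d.kexact_1_iff[OF kexact_P] homology_zero_iff[of "Suc k" n] by (simp add: syzygy_Suc[abs_def])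
next
  case (Suc i)
  interpret d: fi_mor t "P (Suc k)" "pact (Suc k)" t "syzygy k" "pact k" "d (Suc k)"
    by (rule fi_mor_d)
  show ?case
    using d.kexact_shift[OF kexact_P kexact_P] Suc[of "Suc k"] by (simp add: syzygy_Suc[abs_def])
qed

text \<open>One more shift, along \<open>eps\<close>, passes from the first syzygy to
  \<open>V\<close> itself.\<close>

lemma homology_zero_iff_kexact:
  "\<not> fi_homology_nonzero t P pact d k n \<longleftrightarrow> kexact s V act (Suc k) n"
proof -
  interpret eps: fi_mor t "P 0" "pact 0" s V act eps by (rule fi_mor_eps)
  show ?thesis
  proof (cases k)
    case 0
    then show ?thesis
      using eps.kexact_1_iff[OF kexact_P] homology_zero_iff[of 0 n] by (simp add: syzygy_0[abs_def])
  next
    case (Suc i)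
    then show ?thesis
      using eps.kexact_shift[OF kexact_P kexact_P] kexact_syzygy_iff[of 0 i n]
      by (simp add: syzygy_0[abs_def])
  qed
qed

end

section \<open>The two inequalities between regularity and degree\<close>

theorem theorem1p2:
  fixes s :: "'r::comm_ring_1 \<Rightarrow> 'v::ab_group_add \<Rightarrow> 'v"
    and V :: "nat \<Rightarrow> 'v set"
    and act :: "nat \<Rightarrow> nat \<Rightarrow> (nat \<Rightarrow> nat) \<Rightarrow> 'v \<Rightarrow> 'v"
    and t :: "'r \<Rightarrow> 'p::ab_group_add \<Rightarrow> 'p"
    and P :: "nat \<Rightarrow> nat \<Rightarrow> 'p set"
    and pact :: "nat \<Rightarrow> nat \<Rightarrow> nat \<Rightarrow> (nat \<Rightarrow> nat) \<Rightarrow> 'p \<Rightarrow> 'p"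
    and d :: "nat \<Rightarrow> nat \<Rightarrow> 'p \<Rightarrow> 'p"
    and eps :: "nat \<Rightarrow> 'p \<Rightarrow> 'v"
  assumes "fi_module s V act"
    and "fi_fin_gen s V act"
    and "fi_deg V < \<infinity>"
    and "fi_free_resolution s V act t P pact d eps"
  shows "fi_reg t P pact d = fi_deg V"
proof -
  interpret V: fi_mod s V act by (rule fi_modI) fact
  interpret fi_resolution s V act t P pact d eps by unfold_locales fact+
  show ?thesis
  proof (cases "\<forall>n. V n = {0}")
    case True
    \<comment> \<open>For the zero module all homology vanishes, every integer \<open>c\<close> is
      admissible, and both sides are \<open>- \<infinity>\<close>.\<close>
    then have "\<not> fi_homology_nonzero t P pact d k n" for k n
      unfolding homology_zero_iff_kexact by (intro V.kexact_trivial) blast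
    then have "fi_homology_deg t P pact d k = - \<infinity>" for k
      by (simp add: fi_homology_deg_def bot_ereal_def)
    then have "fi_reg t P pact d = Inf (range (\<lambda>c::int. ereal (real_of_int c)))"
      by (simp add: fi_reg_def full_SetCompr_eq)
    also have "\<dots> = - \<infinity>"
    proof (rule ereal_bot)
      fix B :: real
      have "Inf (range (\<lambda>c::int. ereal (real_of_int c))) \<le> ereal (real_of_int \<lfloor>B\<rfloor>)" by (rule Inf_lower) simp
      also have "\<dots> \<le> ereal B" by simp
      finally show "Inf (range (\<lambda>c::int. ereal (real_of_int c))) \<le> ereal B" .
    qed
    finally show ?thesis using True by (simp add: fi_deg_def bot_ereal_def)
  next
    case False
    have le: "ereal (real n) \<le> fi_deg V" if "V n \<noteq> {0}" for n
      unfolding fi_deg_def using that by (intro Sup_upper) blast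
    have "finite {n. V n \<noteq> {0}}"
    proof -
      obtain b :: nat where b: "fi_deg V < ereal (real b)"
        using assms(3) less_PInf_Ex_of_nat[of "fi_deg V"] by auto
      have "n \<le> b" if "V n \<noteq> {0}" for n
        using le_less_trans[OF le[OF that] b] by simp
      then have "{n. V n \<noteq> {0}} \<subseteq> {..b}" by blast
      then show ?thesis using finite_subset by blast
    qed
    moreover define D where "D = Max {n. V n \<noteq> {0}}"
    ultimately have D: "V D \<noteq> {0}" and above: "\<And>k. D < k \<Longrightarrow> V k = {0}"
      using False Max_in[of "{n. V n \<noteq> {0}}"] Max_ge[of "{n. V n \<noteq> {0}}"] by (auto simp: leD)
    have deg: "fi_deg V = ereal (real D)"
      using le[OF D] above unfolding fi_deg_def
      by (intro antisym Sup_least) (auto simp: not_less[symmetric])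
    have "fi_homology_deg t P pact d k \<le> ereal (real D) + ereal (real (Suc k))" for k
      unfolding fi_homology_deg_def
    proof (rule Sup_least, clarify)
      fix n assume "fi_homology_nonzero t P pact d k n"
      \<comment> \<open>Past \<open>D + Suc k\<close> every component of a Koszul chain of degree
        \<open>Suc k\<close> lies in some \<open>V j\<close> with \<open>j > D\<close>.\<close>
      then have "\<not> D + Suc k < n"
        using V.kexact_trivial[of "Suc k" n] above[of "n - Suc k"] homology_zero_iff_kexact[of k n] by linarith
      then show "ereal (real n) \<le> ereal (real D) + ereal (real (Suc k))" by simp
    qed
    then have "fi_reg t P pact d \<le> ereal (real D)"
      unfolding fi_reg_def by (intro Inf_lower) (auto intro!: exI[of _ "int D"])
    moreover have "ereal (real D) \<le> fi_reg t P pact d"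
      unfolding fi_reg_def
    proof (rule Inf_greatest, clarify)
      fix c :: int
      assume c: "\<forall>k. fi_homology_deg t P pact d k \<le> ereal (real_of_int c) + ereal (real (Suc k))"
      obtain v where "v \<in> V D" "v \<noteq> 0" using D V.V_0 by blast
      \<comment> \<open>Index \<open>D\<close> stands for degree \<open>D + 1\<close>, so
        admissibility of \<open>c\<close> gives \<open>2 * D + 1 \<le> c + (D + 1)\<close>, that is
        \<open>D \<le> c\<close>.\<close>
      then have "fi_homology_nonzero t P pact d D (2 * D + 1)"
        using V.not_kexact_top above[of "Suc D"] homology_zero_iff_kexact by blast
      then have "ereal (real (2 * D + 1)) \<le> fi_homology_deg t P pact d D"
        unfolding fi_homology_deg_def by (intro Sup_upper) blast
      also have "\<dots> \<le> ereal (real_of_int c) + ereal (real (Suc D))" using c by blast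
      finally show "ereal (real D) \<le> ereal (real_of_int c)" by simp
    qed
    ultimately show ?thesis using deg by simp
  qed
qed

end
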